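(* For fixed complex $\kappa$, $$B_n(\kappa)\sim\frac{\left(\frac23\right)^{\frac23}}{\Gamma\left(\frac23\right)\left(\frac n2+\frac13\right)^{\frac13}(12\pi)^{\frac n3}}\cos\left(2\pi\kappa-\frac{\pi}{2}n\right)+\frac{\left(\frac23\right)^{\frac13}}{\Gamma\left(\frac13\right)\left(\frac n2+\frac13\right)^{\frac23}(12\pi)^{\frac{n-1}{3}}}\,\kappa\sin\left(2\pi\kappa-\frac{\pi}{2}n\right)$$ as $n\to+\infty$.
   Context: The polynomials $B_n(\kappa)$ are $$B_n(\kappa)=\frac{1}{n!}\left[\frac{d^n}{dt^n}\left(e^{\kappa t}\left(\frac16\frac{t^3}{\sinh t-t}\right)^{\frac{n+1}{3}}\right)\right]_{t=0},$$ the power being the branch equal to $1$ at $t=0$. Here $f(n)\sim g(n)$ means $f(n)=(1+o(1))g(n)$ as $n\to+\infty$. *)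

theory Defs
  imports "HOL-Complex_Analysis.Complex_Analysis" "HOL-Library.Landau_Symbols"
begin

text \<open>
  The function \<open>t^3 / (6 (sinh t - t))\<close> has a removable singularity at 0 with value 1 there;
  the value has to be given explicitly because HOL evaluates the quotient to 0 at 0.
\<close>

definition B_base :: "complex \<Rightarrow> complex" where
  "B_base t = (if t = 0 then 1 else 1 / 6 * (t ^ 3 / (sinh t - t)))"

text \<open>
  The power below is the principal one. As \<open>B_base\<close> is analytic at 0 with value 1, it is, near 0,
  the analytic branch that equals 1 at 0.
\<close>

definition B :: "nat \<Rightarrow> complex \<Rightarrow> complex" where
  "B n \<kappa> = 1 / fact n *
     (deriv ^^ n) (\<lambda>t. exp (\<kappa> * t) * B_base t powr (of_nat (n + 1) / 3)) 0"

end

theory Submission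
  imports Defs "HOL-Real_Asymp.Real_Asymp"
begin

text \<open>
  By Cauchy's formula \<open>B n \<kappa>\<close> is \<open>1 / (2 \<pi> \<i>)\<close> times the integral of
  \<open>e^(\<kappa> t) (6 (sinh t - t))^(- (n + 1) / 3)\<close> around \<open>0\<close>. As contour take the rhombus
  with vertices \<open>\<plusminus> 2 \<pi> \<i>\<close> and \<open>\<plusminus> 2 \<pi> \<surd>3\<close>: its sides leave the critical
  points \<open>\<plusminus> 2 \<pi> \<i>\<close>, where \<open>sinh t - t\<close> is cubically flat, in directions of steepest
  descent, and \<open>|sinh t - t| > 2 \<pi>\<close> everywhere else on it. The integrand has parity under
  \<open>t \<mapsto> - t\<close>, so the upper half of the rhombus suffices, and there it splits exactly into
  \<open>cos (2 \<pi> \<kappa> - \<pi> n / 2)\<close> times an integral with \<open>cosh\<close> plus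
  \<open>sin (2 \<pi> \<kappa> - \<pi> n / 2)\<close> times an integral with \<open>sinh\<close>. Laplace's method on the sides gives
  the size of either integral. Because the splitting is exact, the equivalence survives for those
  \<open>n\<close> at which the cosine, or the whole right-hand side, vanishes.
\<close>

section \<open>The zeros of sinh t - t\<close>

text \<open>The sides are straight, not exact curves of steepest descent: only their direction at
  \<open>2 \<pi> \<i>\<close> and the strict inequality further along them matter. With
  \<open>w = t - 2 \<pi> \<i>\<close>, periodicity gives \<open>\<i> (sinh t - t) / (2 \<pi>) = 1 +
  \<i> (sinh w - w) / (2 \<pi>)\<close>, close to \<open>1 + \<i> w^3 / (12 \<pi>)\<close>. So
  \<open>\<i> w^3 > 0\<close> fixes the directions, and with them the real vertices.

  The exponent \<open>(n + 1) / 3\<close> is fractional, so the branch fixed at \<open>0\<close> has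
  to be followed to the saddle and along the sides. Hence the strip free of nonzero solutions of
  \<open>sinh t = t\<close>, and a holomorphic logarithm on it.

  Near the saddle \<open>cosh\<close> is 1 to leading order, which gives
  \<open>Gamma (1 / 3)\<close> and the decay \<open>n^(-1/3)\<close>; \<open>sinh\<close> starts
  linearly, which gives \<open>Gamma (2 / 3)\<close> and \<open>n^(-2/3)\<close>. The reflection
  formula turns these into the reciprocals \<open>1 / Gamma (2 / 3)\<close> and
  \<open>1 / Gamma (1 / 3)\<close> of the theorem. The first term dominates unless its cosine
  vanishes; then the second term alone must be right up to a factor \<open>1 + o(1)\<close>.\<close>

lemma exp_eq_1_connected_imp_zero:
  fixes d :: "'a::topological_space \<Rightarrow> complex"
  assumes "connected S" "continuous_on S d" "\<And>x. x \<in> S \<Longrightarrow> exp (d x) = 1"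
    and "a \<in> S" "d a = 0" "b \<in> S"
  shows "d b = 0"
proof -
  \<comment> \<open>The values of \<open>d\<close> are multiples of \<open>2 \<pi> \<i>\<close>,
    hence at distance at least \<open>2 \<pi>\<close> from each other. Applied to the difference of
    two continuous logarithms this is their uniqueness on a connected set.\<close>
  have "d constant_on S"
  proof (rule continuous_discrete_range_constant[OF assms(1,2)])
    fix x assume x: "x \<in> S"
    have "2 * pi \<le> norm (d y - d x)" if "y \<in> S" "d y \<noteq> d x" for y
    proof -
      from assms(3)[OF x] assms(3)[OF \<open>y \<in> S\<close>] have "exp (d y) = exp (d x)" by simp
      then obtain n :: int where n: "d y = d x + (of_int (2 * n) * pi) * \<i>"
        unfolding exp_eq by blast
      with that have "n \<noteq> 0" by auto
      then have "1 \<le> \<bar>real_of_int n\<bar>" by linarith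
      then have "2 * pi * 1 \<le> 2 * pi * \<bar>real_of_int n\<bar>"
        by (intro mult_left_mono) auto
      also have "\<dots> = norm (d y - d x)" by (simp add: n norm_mult)
      finally show ?thesis by simp
    qed
    then show "\<exists>e>0. \<forall>y. y \<in> S \<and> d y \<noteq> d x \<longrightarrow> e \<le> norm (d y - d x)"
      by (intro exI[of _ "2 * pi"]) auto
  qed
  then show ?thesis using assms unfolding constant_on_def by metis
qed

section \<open>Elementary inequalities and the cubic limit at the origin\<close>

lemma sinh_Re: "Re (sinh z) = sinh (Re z) * cos (Im z)"
  and sinh_Im: "Im (sinh z) = cosh (Re z) * sin (Im z)"
  by (simp_all add: sinh_field_def cosh_field_def Re_exp Im_exp field_simps)

lemma sinh_cubic_lower:
  fixes x :: real
  assumes "0 \<le> x"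
  shows "x + x ^ 3 / 6 \<le> sinh x"
proof -
  let ?f = "\<lambda>n. if even n then 0 else x ^ n /\<^sub>R fact n"
  have "sum ?f {..<4} \<le> suminf ?f"
    using sinh_converges[of x] assms by (intro sum_le_suminf) (auto simp: sums_iff)
  also have "suminf ?f = sinh x" using sinh_converges[of x] by (simp add: sums_iff)
  also have "{..<4::nat} = {0, 1, 2, 3}" by auto
  also have "sum ?f {0, 1, 2, 3} = x + x ^ 3 / 6" by (simp add: fact_numeral)
  finally show ?thesis .
qed

lemma less_sinh_real:
  fixes x :: real
  assumes "0 < x"
  shows "x < sinh x"
proof -
  have "0 < x ^ 3 / 6" using assms by simp
  with sinh_cubic_lower[of x] assms show ?thesis by linarith
qed

lemma sin_less_self:
  fixes x :: real
  assumes "0 < x"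
  shows "sin x < x"
proof (cases "x \<le> 1")
  case True
  have x: "0 < x / 2" "x / 2 < pi" using assms True pi_gt3 by auto
  have "cos (x / 2) < cos 0" using x by (intro cos_monotone_0_pi) auto
  moreover have "0 < sin (x / 2)" using x by (intro sin_gt_zero)
  ultimately have "sin (x / 2) * cos (x / 2) < sin (x / 2)" by simp
  moreover have "sin (x / 2) \<le> x / 2" using x by (intro sin_x_le_x) auto
  moreover have "sin x = 2 * sin (x / 2) * cos (x / 2)" using sin_double[of "x / 2"] by simp
  ultimately show ?thesis by linarith
next
  case False
  then show ?thesis using sin_le_one[of x] by linarith
qed

lemma mult_cos_less_sin:
  fixes x :: real
  assumes "0 < x" "x < pi"
  shows "x * cos x < sin x"
proof -
  have "sin 0 - 0 * cos 0 < sin x - x * cos x"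
  proof (rule DERIV_pos_imp_increasing_open[OF assms(1)])
    fix u assume u: "0 < u" "u < x"
    have "((\<lambda>x. sin x - x * cos x) has_real_derivative u * sin u) (at u)"
      by (auto intro!: derivative_eq_intros)
    moreover have "0 < u * sin u" using u assms by (auto intro!: mult_pos_pos sin_gt_zero)
    ultimately show "\<exists>y. ((\<lambda>x. sin x - x * cos x) has_real_derivative y) (at u) \<and> 0 < y" by blast
  qed (intro continuous_intros)
  then show ?thesis by simp
qed

lemma sinh_less_mult_cosh:
  fixes x :: real
  assumes "0 < x"
  shows "sinh x < x * cosh x"
proof -
  have "0 * cosh 0 - sinh 0 < x * cosh x - sinh x"
  proof (rule DERIV_pos_imp_increasing_open[OF assms])
    fix u assume u: "0 < u" "u < x"
    have "((\<lambda>x. x * cosh x - sinh x) has_real_derivative u * sinh u) (at u)"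
      by (auto intro!: derivative_eq_intros)
    moreover have "0 < u * sinh u" using u by simp
    ultimately show "\<exists>y. ((\<lambda>x. x * cosh x - sinh x) has_real_derivative y) (at u) \<and> 0 < y" by blast
  qed (intro continuous_intros)
  then show ?thesis by simp
qed

text \<open>Taylor's formula for \<open>sin\<close> at \<open>\<i> * t\<close> leaves an error of
  fifth order, so the quotient is off by O(t). The limit serves twice: it fills the singularity of
  \<open>B_base\<close>, and by periodicity it gives the cubic behaviour at
  \<open>2 \<pi> \<i>\<close>.\<close>

lemma sinh_sub_id_limit: "((\<lambda>t::complex. (sinh t - t) / t ^ 3) \<longlongrightarrow> 1 / 6) (at 0)"
proof -
  have bound: "norm ((sinh t - t) / t ^ 3 - 1 / 6) \<le> exp 1 / 24 * norm t"
    if t: "t \<noteq> 0" "norm t \<le> 1" for t :: complex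
  proof -
    let ?u = "\<i> * t"
    have "norm (sin ?u - (\<Sum>k\<le>4. of_real (sin_coeff k) * ?u ^ k))
            \<le> exp \<bar>Im ?u\<bar> * norm ?u ^ Suc 4 / fact 4"
      by (rule Taylor_sin)
    also have "(\<Sum>k\<le>4. of_real (sin_coeff k) * ?u ^ k) = \<i> * (t + t ^ 3 / 6)"
    proof -
      have "{..4::nat} = {0, 1, 2, 3, 4}" by auto
      then show ?thesis
        by (simp add: sin_coeff_def fact_numeral power_mult_distrib algebra_simps power3_eq_cube)
    qed
    also have "sin ?u = \<i> * sinh t" by (simp add: sinh_conv_sin)
    also have "\<i> * sinh t - \<i> * (t + t ^ 3 / 6) = \<i> * t ^ 3 * ((sinh t - t) / t ^ 3 - 1 / 6)"
      using t by (simp add: field_simps)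
    finally have "norm t ^ 3 * norm ((sinh t - t) / t ^ 3 - 1 / 6)
        \<le> exp \<bar>Re t\<bar> * norm t ^ 5 / 24"
      by (simp add: norm_mult norm_power fact_numeral)
    also have "\<dots> \<le> exp 1 * norm t ^ 4 / 24"
    proof -
      have "exp \<bar>Re t\<bar> \<le> exp 1" using abs_Re_le_cmod[of t] t by simp
      moreover have "norm t ^ 5 \<le> norm t ^ 4" using t by (intro power_decreasing) auto
      ultimately show ?thesis by (intro divide_right_mono mult_mono) auto
    qed
    also have "\<dots> = norm t ^ 3 * (exp 1 / 24 * norm t)" by (simp add: eval_nat_numeral)
    finally show ?thesis using t by simp
  qed
  have "((\<lambda>t::complex. (sinh t - t) / t ^ 3 - 1 / 6) \<longlongrightarrow> 0) (at 0)"
  proof (rule Lim_null_comparison)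
    show "\<forall>\<^sub>F t::complex in at 0. norm ((sinh t - t) / t ^ 3 - 1 / 6) \<le> exp 1 / 24 * norm t"
      unfolding eventually_at using bound by (intro exI[of _ 1]) auto
    show "((\<lambda>t. exp 1 / 24 * norm t) \<longlongrightarrow> 0) (at (0::complex))"
      by (auto intro!: tendsto_eq_intros)
  qed
  then show ?thesis by (simp add: LIM_zero_iff)
qed

text \<open>
  The margin \<open>1 / 2\<close> puts the critical points \<open>\<plusminus> 2 \<pi> \<i>\<close> inside the strip while keeping out the
  nonzero solutions of \<open>sinh t = t\<close>, the nearest of which have \<open>|Im t|\<close> close to \<open>7.5\<close>.
\<close>

definition strip :: "complex set" where
  "strip = {t. \<bar>Im t\<bar> < 2 * pi + 1 / 2}"

lemma convex_strip: "convex strip" and open_strip: "open strip"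
  and strip_uminus: "t \<in> strip \<Longrightarrow> - t \<in> strip" and zero_in_strip: "0 \<in> strip"
proof -
  have eq: "strip = Im -` {- (2 * pi + 1 / 2)<..<2 * pi + 1 / 2}"
    by (auto simp: strip_def)
  show "convex strip" unfolding eq
    by (intro convex_linear_vimage bounded_linear.linear bounded_linear_Im convex_real_interval)
  show "open strip" unfolding eq
    by (intro open_vimage open_greaterThanLessThan continuous_intros)
  show "0 \<in> strip" "t \<in> strip \<Longrightarrow> - t \<in> strip" using pi_gt_zero by (auto simp: strip_def add_pos_pos)
qed

text \<open>With \<open>a\<close>, \<open>b\<close> the absolute real and imaginary parts, the
  equation splits into \<open>sinh a * cos b = a\<close> and \<open>cosh a * sin b = b\<close>. For
  \<open>b < pi\<close>, cross-multiplying them contradicts \<open>b * cos b < sin b\<close> and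
  \<open>sinh a < a * cosh a\<close>. Otherwise \<open>sin b > 0\<close> pushes \<open>b\<close>
  beyond \<open>2 \<pi>\<close>, by less than \<open>1 / 2\<close> because of the strip: then
  \<open>sin b\<close> is so small that \<open>cosh a > 12\<close>, while \<open>cos b\<close> is so
  near 1 that the cubic term of \<open>sinh a\<close> forces \<open>a < 1\<close>.\<close>

lemma sinh_ne_id_in_strip:
  assumes "t \<in> strip" "t \<noteq> 0"
  shows "sinh t \<noteq> t"
proof
  assume eq: "sinh t = t"
  define a b where "a = \<bar>Re t\<bar>" and "b = \<bar>Im t\<bar>"
  have eqs: "sinh (Re t) * cos (Im t) = Re t" "cosh (Re t) * sin (Im t) = Im t"
    using eq by (metis sinh_Re, metis eq sinh_Im)
  have a: "sinh a * cos b = a" and b: "cosh a * sin b = b"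
    using eqs by (auto simp: a_def b_def abs_if)
  have ab: "0 \<le> a" "0 \<le> b" "b < 2 * pi + 1 / 2" "a \<noteq> 0 \<or> b \<noteq> 0"
    using assms by (auto simp: a_def b_def strip_def complex_eq_iff)
  show False
  proof (cases "a = 0")
    case True
    with ab b sin_less_self[of b] show False by auto
  next
    case False
    with ab have a0: "0 < a" by simp
    with a have cos: "0 < cos b" "cos b \<noteq> 1"
      using less_sinh_real[OF a0] by (metis less_trans zero_less_mult_pos, auto)
    then have b0: "0 < b" using ab by (cases "b = 0") auto
    then have sin: "0 < sin b" using b by (metis cosh_real_pos zero_less_mult_pos)
    show False
    proof (cases "b < pi")
      case True
      have "b * cos b * sinh a < sin b * sinh a"
        using mult_cos_less_sin[OF b0 True] a0 by simp
      also have "\<dots> < sin b * (a * cosh a)"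
        using sinh_less_mult_cosh[OF a0] sin by simp
      also have "\<dots> = a * (cosh a * sin b)" by simp
      also have "\<dots> = (sinh a * cos b) * b" by (simp only: a b)
      also have "\<dots> = b * cos b * sinh a" by simp
      finally show False by simp
    next
      case False
      have "2 * pi < b"
        using sin sin_le_zero[of b] False by (cases "b < 2 * pi") (auto simp: not_less le_less)
      define c where "c = b - 2 * pi"
      have c: "0 < c" "c < 1 / 2" using \<open>2 * pi < b\<close> ab by (auto simp: c_def)
      have bc: "sin b = sin c" "cos b = cos c" by (auto simp: c_def sin_diff cos_diff)
      have "sin b < 1 / 2" using sin_less_self[OF c(1)] c bc by simp
      then have "b < cosh a * (1 / 2)" using b by (metis cosh_real_pos mult_strict_left_mono)
      then have "12 < cosh a" using \<open>2 * pi < b\<close> pi_gt3 by simp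
      have "sin (c / 2) ^ 2 \<le> (1 / 4) ^ 2"
        using sin_x_le_x[of "c / 2"] sin_gt_zero[of "c / 2"] c pi_gt3 by (intro power_mono) auto
      then have "7 / 8 \<le> cos b" using cos_double_sin[of "c / 2"] bc
        by (simp add: power2_eq_square)
      then have "sinh a * (7 / 8) \<le> a" using a0 by (subst a[symmetric]) simp
      moreover have "a + a ^ 3 / 6 \<le> sinh a" using sinh_cubic_lower[of a] a0 by simp
      moreover have "a ^ 3 = a * a\<^sup>2" by (simp add: power2_eq_square power3_eq_cube)
      ultimately have "a * a\<^sup>2 \<le> a * (6 / 7)" by linarith
      then have "a\<^sup>2 < 1\<^sup>2" using a0 by simp
      then have "a < 1" using a0 by (intro power_less_imp_less_base[of a 2 1]) auto
      then have "exp a \<le> exp 1" "exp (- a) \<le> 1" using a0 by auto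
      then have "exp a \<le> 3" "exp (- a) \<le> 1" using exp_le by linarith+
      then have "exp a + exp (- a) \<le> 3 + 1" by (rule add_mono)
      then have "cosh a \<le> 2" by (simp add: cosh_field_def)
      with \<open>12 < cosh a\<close> show False by simp
    qed
  qed
qed

lemma B_base_even: "B_base (- t) = B_base t"
proof (cases "t = 0")
  case False
  have "(- t) ^ 3 / (sinh (- t) - - t) = - (t ^ 3) / - (sinh t - t)" by simp
  also have "\<dots> = t ^ 3 / (sinh t - t)" by (rule minus_divide_divide)
  finally show ?thesis using False by (simp add: B_base_def)
qed simp


text \<open>The singularity is removed for the reciprocal \<open>H\<close>, where a limit suffices;
  inverting is harmless since \<open>H\<close> has no zero in the strip.\<close>

lemma B_base_holomorphic: "B_base holomorphic_on strip"
  and B_base_nonzero: "t \<in> strip \<Longrightarrow> B_base t \<noteq> 0"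
proof -
  define H where "H t = (if t = 0 then 1 else 6 * ((sinh t - t) / t ^ 3))" for t :: complex
  have B: "B_base t = 1 / H t" for t by (simp add: B_base_def H_def)
  have nz: "H t \<noteq> 0" if "t \<in> strip" for t
    using sinh_ne_id_in_strip[OF that] by (auto simp: H_def)
  have "H holomorphic_on strip"
  proof (rule no_isolated_singularity'[of "{0}"])
    have "((\<lambda>t. 6 * ((sinh t - t) / t ^ 3)) \<longlongrightarrow> H 0) (at 0)"
      using tendsto_mult_left[OF sinh_sub_id_limit, of 6] by (simp add: H_def)
    then have "(H \<longlongrightarrow> H 0) (at 0)"
      by (rule Lim_transform_eventually) (auto simp: eventually_at H_def intro!: exI[of _ 1])
    then show "(H \<longlongrightarrow> H z) (at z within strip)" if "z \<in> {0}" for z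
      using that by (auto intro: tendsto_within_subset)
    have "(\<lambda>t. 6 * ((sinh t - t) / t ^ 3)) holomorphic_on strip - {0}"
      unfolding sinh_field_def by (intro holomorphic_intros) auto
    then show "H holomorphic_on strip - {0}"
      by (rule holomorphic_transform) (auto simp: H_def)
  qed (auto simp: open_strip)
  then have "(\<lambda>t. 1 / H t) holomorphic_on strip"
    by (intro holomorphic_intros) (auto simp: nz)
  then show "B_base holomorphic_on strip" by (simp add: B[abs_def])
  show "B_base t \<noteq> 0" if "t \<in> strip" using nz[OF that] by (simp add: B)
qed

section \<open>Laplace asymptotics at a cubic critical point\<close>

text \<open>Substitute \<open>v = a * u ^ 3\<close> in Euler's integral for
  \<open>Gamma ((k + 1) / 3)\<close>. The origin is left out because the identity of the two
  integrands uses \<open>u > 0\<close>; for \<open>k = 0\<close> it fails at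
  \<open>u = 0\<close>.\<close>

lemma has_integral_power_exp_cubic:
  fixes a :: real and k :: nat
  assumes a: "a > 0"
  shows "((\<lambda>u. u ^ k * exp (- a * u ^ 3)) has_integral
           Gamma ((real k + 1) / 3) / (3 * a powr ((real k + 1) / 3))) {0<..}"
proof -
  define p where "p = (real k + 1) / 3"
  have p: "p > 0" by (simp add: p_def)
  define f where "f v = v powr (p - 1) / exp v" for v :: real
  have "(f has_integral Gamma p) {0..}"
    unfolding f_def using p by (rule Gamma_integral_real)
  then have f: "(f has_integral Gamma p) {0<..}"
    by (rule has_integral_spike_set_eq[THEN iffD1, rotated -1])
       (auto intro: negligible_subset[of "{0}"])
  then have "f absolutely_integrable_on {0<..}"
    by (intro nonnegative_absolutely_integrable_1) (auto simp: f_def integrable_on_def)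
  moreover have img: "(\<lambda>u. a * u ^ 3) ` {0<..} = {0<..}"
  proof safe
    fix v :: real assume "v > 0"
    then have "v = a * root 3 (v / a) ^ 3" "root 3 (v / a) > 0" using a by simp_all
    then show "v \<in> (\<lambda>u. a * u ^ 3) ` {0<..}" by blast
  qed (use a in auto)
  moreover have "integral {0<..} f = Gamma p" using f by (rule integral_unique)
  ultimately have "f absolutely_integrable_on ((\<lambda>u. a * u ^ 3) ` {0<..}) \<and>
      integral ((\<lambda>u. a * u ^ 3) ` {0<..}) f = Gamma p" by simp
  then have *: "(\<lambda>u. \<bar>3 * a * u ^ 2\<bar> * f (a * u ^ 3)) absolutely_integrable_on {0<..} \<and>
      integral {0<..} (\<lambda>u. \<bar>3 * a * u ^ 2\<bar> * f (a * u ^ 3)) = Gamma p"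
  proof (rule has_absolute_integral_change_of_variables_1'[THEN iffD2, rotated -1])
    show "inj_on (\<lambda>u. a * u ^ 3) {0<..}"
      using a by (intro inj_onI) (auto intro: power_eq_imp_eq_base[of _ 3])
    show "((\<lambda>u. a * u ^ 3) has_field_derivative 3 * a * x ^ 2) (at x within {0<..})" for x
      by (auto intro!: derivative_eq_intros)
  qed auto
  then have "((\<lambda>u. \<bar>3 * a * u ^ 2\<bar> * f (a * u ^ 3)) has_integral Gamma p) {0<..}"
    by (metis has_integral_integral set_lebesgue_integral_eq_integral(1))
  then have "((\<lambda>u. 1 / (3 * a powr p) * (\<bar>3 * a * u ^ 2\<bar> * f (a * u ^ 3))) has_integral
      1 / (3 * a powr p) * Gamma p) {0<..}"
    by (rule has_integral_mult_right)
  moreover have "1 / (3 * a powr p) * (\<bar>3 * a * u ^ 2\<bar> * f (a * u ^ 3)) = u ^ k * exp (- a * u ^ 3)"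
    if "u \<in> {0<..}" for u
  proof -
    have u: "u > 0" using that by simp
    have "(u ^ 3) powr (p - 1) = u powr (3 * (p - 1))"
      using u by (simp add: powr_powr flip: powr_numeral)
    also have "3 * (p - 1) = real k - 2" by (simp add: p_def field_simps)
    also have "u powr (real k - 2) = u ^ k / u ^ 2"
      using u by (simp add: powr_diff powr_realpow)
    finally have *: "(u ^ 3) powr (p - 1) = u ^ k / u ^ 2" .
    have "(a * u ^ 3) powr (p - 1) = a powr (p - 1) * (u ^ 3) powr (p - 1)"
      using a u by (intro powr_mult)
    also have "\<dots> = a powr p / a * (u ^ k / u ^ 2)"
      using a unfolding * by (simp add: powr_diff)
    finally have "(a * u ^ 3) powr (p - 1) = a powr p / a * (u ^ k / u ^ 2)" .
    then show ?thesis using a u by (simp add: f_def exp_minus field_simps)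
  qed
  ultimately show ?thesis unfolding p_def by (subst has_integral_cong[symmetric]) auto
qed

text \<open>The large parameter is \<open>r n ^ 3\<close>, so the linear substitution
  \<open>x = u / r n\<close> turns the exponent into one tending to \<open>- a * u ^ 3\<close>. The
  bounds on \<open>E\<close> and \<open>h\<close> become the majorant
  \<open>C * (u ^ k * exp (- c * u ^ 3))\<close>, the same for all \<open>n\<close>, and dominated
  convergence applies.\<close>

lemma Laplace_cubic_dominated:
  fixes h E :: "real \<Rightarrow> complex" and r :: "nat \<Rightarrow> real"
  assumes cont: "continuous_on {0..1} h" "continuous_on {0..1} E"
    and c: "0 < c" "\<And>x. x \<in> {0<..1} \<Longrightarrow> c * x ^ 3 \<le> Re (E x)"
    and C: "\<And>x. x \<in> {0<..1} \<Longrightarrow> norm (h x) \<le> C * x ^ k"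
    and E_lim: "((\<lambda>x. E x / of_real x ^ 3) \<longlongrightarrow> of_real a) (at_right 0)" and a: "0 < a"
    and h_lim: "((\<lambda>x. h x / of_real x ^ k) \<longlongrightarrow> h0) (at_right 0)"
    and r: "filterlim r at_top sequentially" "\<And>n. 0 < r n"
  shows "(\<lambda>n. of_real (r n) ^ (k + 1) * integral {0..1} (\<lambda>x. h x * exp (- (of_real (r n) ^ 3 * E x))))
           \<longlonglongrightarrow> h0 * of_real (Gamma ((real k + 1) / 3) / (3 * a powr ((real k + 1) / 3)))"
proof -
  define G where "G n u = of_real (r n) ^ k *
      (h (u / r n) * exp (- (of_real (r n) ^ 3 * E (u / r n))))" for n u
  \<comment> \<open>Extension by zero beyond \<open>r n\<close> puts all the rescaled integrands on
    one domain.\<close>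
  define f where "f n u = (if u \<in> {0<..r n} then G n u else 0)" for n u
  define g where "g u = h0 * of_real (u ^ k * exp (- a * u ^ 3))" for u
  define I where "I n = integral {0..1} (\<lambda>x. h x * exp (- (of_real (r n) ^ 3 * E x)))" for n
  have fI: "(f n has_integral of_real (r n) ^ (k + 1) * I n) {0<..}" for n
  proof -
    have "(\<lambda>x. h x * exp (- (of_real (r n) ^ 3 * E x))) integrable_on {0..1}"
      by (intro integrable_continuous_real continuous_intros cont)
    then have "((\<lambda>x. h x * exp (- (of_real (r n) ^ 3 * E x))) has_integral I n) (cbox 0 1)"
      unfolding I_def by (simp add: has_integral_integral)
    from has_integral_affinity'[OF this, of "1 / r n" 0]
    have "((\<lambda>u. h (u / r n) * exp (- (of_real (r n) ^ 3 * E (u / r n)))) has_integral r n *\<^sub>R I n) {0..r n}"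
      using r(2)[of n] by simp
    from has_integral_mult_right[OF this, of "of_real (r n) ^ k"]
    have "(G n has_integral of_real (r n) ^ (k + 1) * I n) {0..r n}"
      by (simp add: G_def[abs_def] scaleR_conv_of_real mult_ac)
    then have "(G n has_integral of_real (r n) ^ (k + 1) * I n) {0<..r n}"
      by (rule has_integral_spike_set_eq[THEN iffD1, rotated -1])
         (auto intro: negligible_subset[of "{0}"])
    then show ?thesis unfolding f_def[abs_def]
      by (subst has_integral_restrict) auto
  qed
  have C0: "0 \<le> C" using C[of 1] norm_ge_zero[of "h 1"] by (simp del: norm_ge_zero)
  have "(\<lambda>n. integral {0<..} (f n)) \<longlonglongrightarrow> integral {0<..} g"
  proof (rule dominated_convergence)
    show "f n integrable_on {0<..}" for n using fI by blast
    show "(\<lambda>u. C * (u ^ k * exp (- c * u ^ 3))) integrable_on {0<..}"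
      by (intro integrable_on_mult_right has_integral_integrable[OF has_integral_power_exp_cubic] c)
    show "norm (f n u) \<le> C * (u ^ k * exp (- c * u ^ 3))" if "u \<in> {0<..}" for n u
    proof (cases "u \<le> r n")
      case True
      have rn: "r n > 0" by (rule r)
      have x: "u / r n \<in> {0<..1}" using True that rn by simp
      have "norm (f n u) = r n ^ k * norm (h (u / r n)) * exp (- (r n ^ 3 * Re (E (u / r n))))"
        using True that rn
        by (simp add: f_def G_def norm_mult norm_power flip: of_real_power)
      also have "\<dots> \<le> r n ^ k * (C * (u / r n) ^ k) * exp (- (r n ^ 3 * (c * (u / r n) ^ 3)))"
        using C0 rn that by (intro mult_mono C c(2) x) (auto intro!: c(2)[OF x])
      also have "\<dots> = C * (u ^ k * exp (- c * u ^ 3))"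
        using rn by (simp add: power_divide)
      finally show ?thesis .
    qed (use that C0 in \<open>auto simp: f_def\<close>)
    show "(\<lambda>n. f n u) \<longlonglongrightarrow> g u" if "u \<in> {0<..}" for u
    proof -
      have u: "u > 0" using that by simp
      have lim: "filterlim (\<lambda>n. u / r n) (at_right 0) sequentially"
        unfolding filterlim_at
      proof
        show "(\<lambda>n. u / r n) \<longlonglongrightarrow> 0"
          by (intro real_tendsto_divide_at_top[OF tendsto_const r(1)])
        show "\<forall>\<^sub>F n in sequentially. u / r n \<in> {0<..} \<and> u / r n \<noteq> 0"
          using u r(2) by (auto simp: less_imp_neq[symmetric])
      qed
      have "(\<lambda>n. of_real (u ^ k) * (h (u / r n) / of_real (u / r n) ^ k) *
              exp (- (of_real (u ^ 3) * (E (u / r n) / of_real (u / r n) ^ 3))))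
            \<longlonglongrightarrow> of_real (u ^ k) * h0 * exp (- (of_real (u ^ 3) * of_real a))"
        by (intro tendsto_intros filterlim_compose[OF h_lim lim] filterlim_compose[OF E_lim lim])
      also have "(\<lambda>n. of_real (u ^ k) * (h (u / r n) / of_real (u / r n) ^ k) *
              exp (- (of_real (u ^ 3) * (E (u / r n) / of_real (u / r n) ^ 3)))) = (\<lambda>n. G n u)"
        using u r(2) by (intro ext) (simp add: G_def power_divide less_imp_neq[symmetric] mult_ac)
      also have "of_real (u ^ k) * h0 * exp (- (of_real (u ^ 3) * of_real a)) = g u"
        by (simp add: g_def exp_of_real[symmetric] mult_ac)
      finally show ?thesis
      proof (rule Lim_transform_eventually)
        show "\<forall>\<^sub>F n in sequentially. G n u = f n u"
          using r(1)[unfolded filterlim_at_top, rule_format, of u]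
          by (rule eventually_mono) (use u in \<open>auto simp: f_def\<close>)
      qed
    qed
  qed
  moreover have "integral {0<..} (f n) = of_real (r n) ^ (k + 1) * I n" for n
    using fI by (rule integral_unique)
  moreover have "integral {0<..} g = h0 * of_real (Gamma ((real k + 1) / 3) / (3 * a powr ((real k + 1) / 3)))"
    unfolding g_def
    by (intro integral_unique has_integral_mult_right has_integral_of_real has_integral_power_exp_cubic a)
  ultimately show ?thesis by (simp add: I_def)
qed

text \<open>Filling in the limit at \<open>0\<close> makes the quotient continuous on a compact
  interval, so that it attains its extrema.\<close>

lemma continuous_on_quotient_power:
  fixes f :: "real \<Rightarrow> 'a::real_normed_field"
  assumes f: "continuous_on {0..1} f"
    and lim: "((\<lambda>x. f x / of_real x ^ k) \<longlongrightarrow> l) (at_right 0)"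
  shows "continuous_on {0..1} (\<lambda>x. if x = 0 then l else f x / of_real x ^ k)"
proof (rule continuous_on_eq_continuous_within[THEN iffD2], rule ballI)
  let ?g = "\<lambda>x. if x = 0 then l else f x / of_real x ^ k"
  fix x :: real assume x: "x \<in> {0..1}"
  show "continuous (at x within {0..1}) ?g"
  proof (cases "x = 0")
    case True
    have "(?g \<longlongrightarrow> l) (at_right 0)"
      by (rule Lim_transform_eventually[OF lim]) (auto simp: eventually_at intro!: exI[of _ 1])
    then show ?thesis
      using True by (simp add: continuous_within at_within_Icc_at_right)
  next
    case False
    have "continuous (at x within {0..1}) f"
      using f x by (simp add: continuous_on_eq_continuous_within)
    then have "continuous (at x within {0..1}) (\<lambda>x. f x / of_real x ^ k)"
      using False by (intro continuous_intros) auto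
    then show ?thesis
      by (rule continuous_transform_within[of _ _ _ "\<bar>x\<bar>"])
         (use False x in \<open>auto simp: dist_real_def\<close>)
  qed
qed

text \<open>Quantitative bounds come for free by compactness: \<open>c\<close> is the minimum of the
  real part of \<open>E x / x ^ 3\<close>, positive at \<open>0\<close> because of \<open>a\<close>
  and elsewhere because of \<open>pos\<close>; \<open>C\<close> is the maximum of
  \<open>|h x| / x ^ k\<close>. Strict positivity of \<open>Re E\<close> is thus all that the
  contour has to supply.\<close>

lemma Laplace_cubic:
  fixes h E :: "real \<Rightarrow> complex" and r :: "nat \<Rightarrow> real"
  assumes cont: "continuous_on {0..1} h" "continuous_on {0..1} E"
    and pos: "\<And>x. x \<in> {0<..1} \<Longrightarrow> 0 < Re (E x)"
    and E_lim: "((\<lambda>x. E x / of_real x ^ 3) \<longlongrightarrow> of_real a) (at_right 0)" and a: "0 < a"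
    and h_lim: "((\<lambda>x. h x / of_real x ^ k) \<longlongrightarrow> h0) (at_right 0)"
    and r: "filterlim r at_top sequentially" "\<And>n. 0 < r n"
  shows "(\<lambda>n. of_real (r n) ^ (k + 1) * integral {0..1} (\<lambda>x. h x * exp (- (of_real (r n) ^ 3 * E x))))
           \<longlonglongrightarrow> h0 * of_real (Gamma ((real k + 1) / 3) / (3 * a powr ((real k + 1) / 3)))"
proof -
  define \<phi> where "\<phi> x = Re (if x = 0 then of_real a else E x / of_real x ^ 3)" for x
  have "continuous_on {0..1} \<phi>" unfolding \<phi>_def[abs_def]
    by (intro continuous_on_Re continuous_on_quotient_power cont E_lim)
  then obtain x0 where x0: "x0 \<in> {0..1}" "\<And>x. x \<in> {0..1} \<Longrightarrow> \<phi> x0 \<le> \<phi> x"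
    using continuous_attains_inf[of "{0..1}" \<phi>] by auto
  have Re_E: "Re (E x) = \<phi> x * x ^ 3" if "x \<in> {0<..1}" for x
    using that by (simp add: \<phi>_def flip: of_real_power)
  have "0 < \<phi> x" if "x \<in> {0..1}" for x
    using that a pos[of x] by (auto simp: \<phi>_def simp flip: of_real_power)
  then have c: "0 < \<phi> x0" using x0 by blast
  have "continuous_on {0..1} (\<lambda>x. norm (if x = 0 then h0 else h x / of_real x ^ k))"
    by (intro continuous_on_norm continuous_on_quotient_power cont h_lim)
  then obtain x1 where "\<forall>x\<in>{0..1}. norm (if x = 0 then h0 else h x / of_real x ^ k)
      \<le> norm (if x1 = 0 then h0 else h x1 / of_real x1 ^ k)"
    using continuous_attains_sup[of "{0..1::real}"] by fastforce
  then obtain C where C: "\<And>x. x \<in> {0..1} \<Longrightarrow> norm (if x = 0 then h0 else h x / of_real x ^ k) \<le> C" by blast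
  show ?thesis
  proof (rule Laplace_cubic_dominated[OF cont c _ _ E_lim a h_lim r])
    fix x :: real assume x: "x \<in> {0<..1}"
    then show "\<phi> x0 * x ^ 3 \<le> Re (E x)"
      using x0(2)[of x] by (simp add: Re_E[OF x] mult_right_mono)
    have "norm (h x / of_real x ^ k) \<le> C" using C[of x] x by simp
    then show "norm (h x) \<le> C * x ^ k"
      using x by (simp add: norm_divide norm_power pos_divide_le_eq)
  qed
qed

section \<open>The contour integral\<close>

lemma exists_log_B_base:
  "\<exists>L. L holomorphic_on strip \<and> (\<forall>t\<in>strip. exp (L t) = B_base t) \<and> L 0 = 0"
proof -
  obtain g where g: "g holomorphic_on strip" "\<And>t. t \<in> strip \<Longrightarrow> exp (g t) = B_base t"
    using holomorphic_logarithm_exists[OF convex_strip open_strip B_base_holomorphic B_base_nonzero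
        zero_in_strip] by metis
  have "exp (g 0) = 1" using g(2)[OF zero_in_strip] by (simp add: B_base_def)
  then show ?thesis using g
    by (intro exI[of _ "\<lambda>t. g t - g 0"]) (auto intro!: holomorphic_intros simp: exp_diff)
qed

text \<open>The normalisation at \<open>0\<close> selects the branch of the theorem; holomorphy on
  the whole strip carries it to the saddle and the sides.\<close>

definition log_B_base :: "complex \<Rightarrow> complex" where
  "log_B_base = (SOME L. L holomorphic_on strip \<and> (\<forall>t\<in>strip. exp (L t) = B_base t) \<and> L 0 = 0)"

lemma log_B_base_holomorphic: "log_B_base holomorphic_on strip"
  and exp_log_B_base: "t \<in> strip \<Longrightarrow> exp (log_B_base t) = B_base t"
  and log_B_base_0: "log_B_base 0 = 0"
  using someI_ex[OF exists_log_B_base] unfolding log_B_base_def by blast+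

text \<open>Evenness of \<open>B_base\<close> alone would leave the fractional power even only up to
  a root of unity. The two logarithms agree at \<open>0\<close>, hence on the connected
  strip.\<close>

lemma log_B_base_even:
  assumes "t \<in> strip"
  shows "log_B_base (- t) = log_B_base t"
proof -
  have "log_B_base (- t) - log_B_base t = 0"
  proof (rule exp_eq_1_connected_imp_zero[where S = strip and a = 0 and b = t
        and d = "\<lambda>t. log_B_base (- t) - log_B_base t"])
    show "connected strip" by (rule convex_connected[OF convex_strip])
    have "continuous_on strip (\<lambda>t. log_B_base (- t))"
      by (rule continuous_on_compose2[OF holomorphic_on_imp_continuous_on[OF log_B_base_holomorphic]])
         (auto intro: continuous_intros strip_uminus)
    then show "continuous_on strip (\<lambda>t. log_B_base (- t) - log_B_base t)"
      by (intro continuous_intros holomorphic_on_imp_continuous_on[OF log_B_base_holomorphic])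
  qed (auto simp: exp_diff exp_log_B_base strip_uminus B_base_even B_base_nonzero zero_in_strip assms)
  then show ?thesis by simp
qed

text \<open>On the segment from \<open>0\<close> to \<open>2 \<pi> \<i>\<close> the function
  \<open>B_base\<close> is real and positive, \<open>y^3 / (6 (y - sin y))\<close>, so the continued
  logarithm stays equal to the real one. At \<open>y = 2 \<pi>\<close> the sine vanishes and the
  value is \<open>2 \<pi>^2 / 3\<close>.\<close>

lemma log_B_base_saddle: "log_B_base (2 * pi * \<i>) = of_real (ln (2 * pi ^ 2 / 3))"
proof -
  have strip: "\<i> * of_real y \<in> strip" if "y \<in> {0..2 * pi}" for y
    using that by (auto simp: strip_def)
  have B_real: "B_base (\<i> * of_real y) = of_real (if y = 0 then 1 else y ^ 3 / (6 * (y - sin y)))" for y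
  proof (cases "y = 0")
    case False
    have "sinh (\<i> * of_real y) = \<i> * of_real (sin y)"
      by (simp add: sinh_conv_sin sin_of_real)
    moreover have "(\<i> * of_real y) ^ 3 = - \<i> * of_real (y ^ 3)"
      by (simp add: power3_eq_cube mult_ac)
    ultimately have "B_base (\<i> * of_real y) = (- \<i> * of_real (y ^ 3)) / (- \<i> * of_real (6 * (y - sin y)))"
      using False by (simp add: B_base_def algebra_simps)
    also have "\<dots> = of_real (y ^ 3 / (6 * (y - sin y)))"
      by (subst mult_divide_mult_cancel_left) auto
    finally show ?thesis using False by simp
  qed (simp add: B_base_def)
  have B_pos: "0 < Re (B_base (\<i> * of_real y))" if "y \<in> {0..2 * pi}" for y
    using that sin_less_self[of y] by (auto simp: B_real intro!: divide_pos_pos)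
  have "log_B_base (\<i> * of_real (2 * pi)) - of_real (ln (Re (B_base (\<i> * of_real (2 * pi))))) = 0"
  proof (rule exp_eq_1_connected_imp_zero[where S = "{0..2 * pi}" and a = 0 and b = "2 * pi" and
        d = "\<lambda>y. log_B_base (\<i> * of_real y) - of_real (ln (Re (B_base (\<i> * of_real y))))"])
    have "continuous_on {0..2 * pi} (\<lambda>y. g (\<i> * of_real y))" if "g holomorphic_on strip" for g
      by (rule continuous_on_compose2[OF holomorphic_on_imp_continuous_on[OF that]])
         (auto intro!: continuous_intros strip)
    note this[OF B_base_holomorphic] this[OF log_B_base_holomorphic]
    then show "continuous_on {0..2 * pi}
        (\<lambda>y. log_B_base (\<i> * of_real y) - of_real (ln (Re (B_base (\<i> * of_real y)))))"
      by (intro continuous_intros) (auto simp: B_pos less_imp_neq[symmetric])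
    show "exp (log_B_base (\<i> * of_real y) - of_real (ln (Re (B_base (\<i> * of_real y))))) = 1"
      if "y \<in> {0..2 * pi}" for y
    proof -
      have "complex_of_real (Re (B_base (\<i> * of_real y))) = B_base (\<i> * of_real y)"
        by (simp add: B_real)
      with B_pos[OF that] B_base_nonzero[OF strip[OF that]] exp_log_B_base[OF strip[OF that]]
      show ?thesis by (simp add: exp_diff exp_of_real)
    qed
  qed (auto simp: log_B_base_0 B_base_def)
  moreover have "Re (B_base (\<i> * of_real (2 * pi))) = 2 * pi ^ 2 / 3"
    unfolding B_real by (simp add: eval_nat_numeral)
  moreover have "\<i> * of_real (2 * pi) = 2 * pi * \<i>" by simp
  ultimately show ?thesis by (simp only: eq_iff_diff_eq_0[symmetric] right_minus_eq)
qed

text \<open>Derivatives at \<open>0\<close> depend only on the germ there, and while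
  \<open>|log_B_base t| < pi\<close> the principal logarithm of \<open>B_base t\<close> coincides
  with \<open>log_B_base t\<close>.\<close>

lemma B_eq_deriv_log_B_base:
  "B n \<kappa> = (deriv ^^ n) (\<lambda>t. exp (\<kappa> * t) * exp (of_real ((real n + 1) / 3) * log_B_base t)) 0 / fact n"
proof -
  have "isCont log_B_base 0"
    using log_B_base_holomorphic open_strip zero_in_strip
    by (meson continuous_on_eq_continuous_at holomorphic_on_imp_continuous_on)
  then have "(log_B_base \<longlongrightarrow> log_B_base 0) (nhds 0)"
    unfolding isCont_def by (simp only: tendsto_at_iff_tendsto_nhds)
  then have "((\<lambda>t. norm (log_B_base t)) \<longlongrightarrow> norm (log_B_base 0)) (nhds 0)"
    by (rule tendsto_norm)
  then have "\<forall>\<^sub>F t in nhds 0. norm (log_B_base t) < pi"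
    by (rule order_tendstoD(2)) (simp add: log_B_base_0)
  moreover have "\<forall>\<^sub>F t in nhds 0. t \<in> strip"
    using open_strip zero_in_strip by (rule eventually_nhds_in_open)
  ultimately have "\<forall>\<^sub>F t in nhds 0. exp (\<kappa> * t) * B_base t powr (of_nat (n + 1) / 3) =
      exp (\<kappa> * t) * exp (of_real ((real n + 1) / 3) * log_B_base t)"
  proof eventually_elim
    case (elim t)
    then have "\<bar>Im (log_B_base t)\<bar> < pi" using abs_Im_le_cmod[of "log_B_base t"] by linarith
    then have "Ln (B_base t) = log_B_base t"
      using exp_log_B_base[OF elim(2)] by (intro Ln_unique) auto
    then show ?case using B_base_nonzero[OF elim(2)] by (simp add: powr_def add.commute)
  qed
  from higher_deriv_cong_ev[OF this refl] show ?thesis by (simp add: B_def)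
qed

text \<open>The factor \<open>sqrt 3\<close> gives the sides the directions
  \<open>2 \<pi> (\<plusminus> sqrt 3 - \<i>)\<close>, of modulus \<open>4 \<pi>\<close> and
  inclined by \<open>\<pi> / 6\<close> below the horizontal.\<close>

definition apex :: complex where "apex = of_real (2 * pi * sqrt 3)"

definition half_rhombus :: "real \<Rightarrow> complex" where
  "half_rhombus = linepath apex (2 * pi * \<i>) +++ linepath (2 * pi * \<i>) (- apex)"

lemma half_rhombus_simps [simp]:
  "valid_path half_rhombus" "pathstart half_rhombus = apex" "pathfinish half_rhombus = - apex"
  by (simp_all add: half_rhombus_def)

lemma edge_point:
  assumes "e = apex \<or> e = - apex" "t \<in> closed_segment (2 * pi * \<i>) e"
  shows "t \<in> strip" "0 \<le> Im t" "t \<noteq> 0" "norm t < 4 * pi"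
proof -
  obtain u where u: "0 \<le> u" "u \<le> 1" "t = (1 - u) *\<^sub>R (2 * pi * \<i>) + u *\<^sub>R e"
    using assms(2) unfolding closed_segment_def by blast
  have t: "Im t = (1 - u) * (2 * pi)" "Re t = u * Re e"
    using assms(1) by (auto simp: u apex_def)
  have e: "Re e \<noteq> 0" using assms(1) by (auto simp: apex_def)
  show "0 \<le> Im t" unfolding t using u by simp
  have "Im t \<le> 1 * (2 * pi)" unfolding t using u by (intro mult_right_mono) auto
  with \<open>0 \<le> Im t\<close> show "t \<in> strip" by (simp add: strip_def)
  show "t \<noteq> 0" using t e by (cases "u = 0") auto
  have "sqrt 3 < sqrt (2 ^ 2)" by (intro real_sqrt_less_mono) simp
  then have "2 * pi * \<bar>sqrt 3\<bar> < 4 * pi" by simp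
  then have "norm e < 4 * pi" "norm (2 * pi * \<i>) < 4 * pi"
    using assms(1) by (auto simp: apex_def norm_mult)
  then have "closed_segment (2 * pi * \<i>) e \<subseteq> ball 0 (4 * pi)"
    by (intro closed_segment_subset convex_ball) auto
  with assms(2) show "norm t < 4 * pi" by auto
qed

lemma path_image_half_rhombus:
  "path_image half_rhombus = closed_segment (2 * pi * \<i>) apex \<union> closed_segment (2 * pi * \<i>) (- apex)"
  by (simp add: half_rhombus_def path_image_join closed_segment_commute)

lemma half_rhombus_point:
  assumes "t \<in> path_image half_rhombus"
  shows "t \<in> strip" "0 \<le> Im t" "t \<noteq> 0"
  using assms edge_point unfolding path_image_half_rhombus by blast+

lemma rotated_not_nonpos_Reals:
  assumes "0 \<le> Im t" "t \<noteq> 0"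
  shows "- \<i> * t \<notin> \<real>\<^sub>\<le>\<^sub>0"
  using assms by (auto simp: complex_nonpos_Reals_iff complex_eq_iff)

text \<open>The rotation by \<open>- \<i>\<close> moves the closed upper half plane without
  \<open>0\<close> off the slit, so \<open>Ln (- \<i> * t)\<close> is a primitive of
  \<open>1 / t\<close> there, increasing by \<open>\<pi> \<i>\<close> along the path. The reflected
  path supplies the other half turn.\<close>

lemma winding_number_half_rhombus: "winding_number half_rhombus 0 = 1 / 2"
proof -
  obtain p where p: "apex = of_real p" "0 < p"
    using that[of "2 * pi * sqrt 3"] by (simp add: apex_def)
  have "((\<lambda>t. 1 / t) has_contour_integral (Ln (- \<i> * (- apex)) - Ln (- \<i> * apex))) half_rhombus"
    using contour_integral_primitive[of "path_image half_rhombus" "\<lambda>t. Ln (- \<i> * t)" "\<lambda>t. 1 / t" half_rhombus]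
      rotated_not_nonpos_Reals half_rhombus_point
    by (force intro!: derivative_eq_intros simp: field_simps)
  moreover have "Ln (- \<i> * (- apex)) = of_real (ln p) + \<i> * (pi / 2)"
    using p order_trans[of "- (pi / 2)" 0 pi] by (intro Ln_unique) (auto simp: complex_eq_iff Re_exp Im_exp)
  moreover have "Ln (- \<i> * apex) = of_real (ln p) - \<i> * (pi / 2)"
    using p order_trans[of "- (pi / 2)" 0 pi] by (intro Ln_unique) (auto simp: complex_eq_iff Re_exp Im_exp)
  ultimately have "contour_integral half_rhombus (\<lambda>t. 1 / t) = pi * \<i>"
    by (simp add: contour_integral_unique mult_ac)
  then show ?thesis
    using half_rhombus_point(3) by (subst winding_number_valid_path) auto
qed

text \<open>The residue theorem on the closed rhombus, whose lower half is the reflection of the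
  upper one. Folding it back changes the sign of \<open>dt\<close>, which explains the difference on
  the right.\<close>

lemma higher_deriv_half_rhombus:
  assumes f: "f holomorphic_on strip"
  shows "(deriv ^^ n) f 0 / fact n =
    1 / (2 * pi * \<i>) * contour_integral half_rhombus (\<lambda>t. f t / t ^ Suc n - f (- t) / (- t) ^ Suc n)"
proof -
  define g where "g = half_rhombus +++ (uminus \<circ> half_rhombus)"
  define F where "F t = f t / t ^ Suc n" for t
  have neg: "valid_path (uminus \<circ> half_rhombus)" by (simp add: valid_path_negatepath)
  have neg_ends: "pathstart (uminus \<circ> half_rhombus) = - apex" "pathfinish (uminus \<circ> half_rhombus) = apex"
    by (simp_all add: pathstart_compose pathfinish_compose)
  have neg_img: "path_image (uminus \<circ> half_rhombus) = uminus ` path_image half_rhombus"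
    by (simp add: path_image_compose)
  have g: "valid_path g" "pathfinish g = pathstart g"
    by (simp_all add: g_def neg neg_ends)
  have sub: "path_image half_rhombus \<subseteq> strip - {0}" "path_image (uminus \<circ> half_rhombus) \<subseteq> strip - {0}"
    using half_rhombus_point strip_uminus by (auto simp: neg_img)
  have g_sub: "path_image g \<subseteq> strip - {0}"
    using sub by (simp add: g_def path_image_join neg_ends)
  have F: "F holomorphic_on strip - {0}"
    unfolding F_def using f by (auto intro!: holomorphic_intros intro: holomorphic_on_subset)
  have "winding_number g 0 = winding_number half_rhombus 0 + winding_number (uminus \<circ> half_rhombus) 0"
    unfolding g_def using sub by (intro winding_number_join) (auto simp: valid_path_imp_path neg neg_ends)
  also have "winding_number (uminus \<circ> half_rhombus) 0 = winding_number half_rhombus 0"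
    using sub by (intro winding_number_negatepath) auto
  finally have wind: "winding_number g 0 = 1" by (simp add: winding_number_half_rhombus)
  have "contour_integral g F = 2 * pi * \<i> * (\<Sum>p\<in>{0}. winding_number g p * residue F p)"
  proof (rule Residue_theorem[of strip])
    show "\<forall>z. z \<notin> strip \<longrightarrow> winding_number g z = 0"
      using g g_sub convex_strip by (auto intro!: winding_number_zero_outside valid_path_imp_path)
  qed (use open_strip convex_connected[OF convex_strip] F g g_sub in auto)
  moreover have "residue F 0 = (deriv ^^ n) f 0 / fact n"
    unfolding F_def using open_strip zero_in_strip f by (intro residue_holomorphic_over_power')
  ultimately have "(deriv ^^ n) f 0 / fact n = 1 / (2 * pi * \<i>) * contour_integral g F"
    by (simp add: wind)
  also have "contour_integral g F = contour_integral half_rhombus (\<lambda>t. F t - F (- t))"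
  proof -
    have int: "F contour_integrable_on half_rhombus" "F contour_integrable_on (uminus \<circ> half_rhombus)"
      using sub F neg open_strip by (auto intro!: contour_integrable_holomorphic_simple[where S = "strip - {0}"])
    have "F \<circ> uminus holomorphic_on strip - {0}"
      by (rule holomorphic_on_compose_gen[OF _ F]) (auto intro: holomorphic_intros strip_uminus)
    then have int': "(\<lambda>t. F (- t)) contour_integrable_on half_rhombus"
      using sub open_strip
      by (auto intro!: contour_integrable_holomorphic_simple[where S = "strip - {0}"] simp: o_def)
    have "contour_integral g F = contour_integral half_rhombus F + contour_integral (uminus \<circ> half_rhombus) F"
      unfolding g_def by (rule contour_integral_join[OF int]) (simp_all add: neg)
    also have "contour_integral (uminus \<circ> half_rhombus) F = - contour_integral half_rhombus (\<lambda>t. F (- t))"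
      by (rule contour_integral_negatepath) simp
    finally show ?thesis using contour_integral_diff[OF int(1) int'] by simp
  qed
  finally show ?thesis by (simp add: F_def)
qed

section \<open>The exponent along the sides of the rhombus\<close>

lemma sin_cubic_lower:
  fixes x :: real
  assumes "0 \<le> x"
  shows "x - x ^ 3 / 6 \<le> sin x"
proof -
  have "sin 0 - 0 + (0::real) ^ 3 / 6 \<le> sin x - x + x ^ 3 / 6"
  proof (rule DERIV_nonneg_imp_nondecreasing[OF assms])
    fix u :: real assume u: "0 \<le> u"
    have "((\<lambda>x. sin x - x + x ^ 3 / 6) has_real_derivative cos u - 1 + u ^ 2 / 2) (at u)"
      by (auto intro!: derivative_eq_intros)
    moreover have "\<bar>sin (u / 2)\<bar> \<le> \<bar>u / 2\<bar>" by (rule abs_sin_x_le_abs_x)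
    then have "sin (u / 2) ^ 2 \<le> (u / 2) ^ 2" by (simp only: abs_le_square_iff)
    then have "0 \<le> cos u - 1 + u ^ 2 / 2"
      using cos_double_sin[of "u / 2"] by (simp add: power2_eq_square)
    ultimately show "\<exists>y. ((\<lambda>x. sin x - x + x ^ 3 / 6) has_real_derivative y) (at u) \<and> 0 \<le> y" by blast
  qed
  then show ?thesis by simp
qed

lemma cosh_quadratic_lower: "1 + x ^ 2 / 2 \<le> cosh (x :: real)"
proof -
  have "(\<bar>x\<bar> / 2) ^ 2 \<le> sinh (\<bar>x\<bar> / 2) ^ 2"
    using less_sinh_real[of "\<bar>x\<bar> / 2"] by (intro power_mono) (cases "x = 0", auto)
  also have "sinh (\<bar>x\<bar> / 2) ^ 2 = (cosh \<bar>x\<bar> - 1) / 2"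
    using cosh_double[of "\<bar>x\<bar> / 2"] cosh_square_eq[of "\<bar>x\<bar> / 2"] by simp
  finally show ?thesis by (simp add: power_divide)
qed

text \<open>The Taylor polynomial of degree 7, in Horner form. The threshold lies just below
  \<open>1.73 * 2.3\<close>, a lower bound for \<open>|Re t|\<close> on the far part of a side, and
  24 exceeds \<open>6 \<pi>\<close>.\<close>

lemma sinh_large:
  fixes x :: real
  assumes "397 / 100 \<le> x"
  shows "24 < sinh x"
proof -
  have "397 / 100 * (1 + (397 / 100) ^ 2 / 6 * (1 + (397 / 100) ^ 2 / 20 * (1 + (397 / 100)\<^sup>2 / 42)))
      \<le> x * (1 + x ^ 2 / 6 * (1 + x ^ 2 / 20 * (1 + x\<^sup>2 / 42)))"
    using assms by (intro mult_mono add_mono divide_right_mono power_mono) auto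
  also have "\<dots> = x + x ^ 3 / 6 + x ^ 5 / 120 + x ^ 7 / 5040"
    by (simp add: field_simps eval_nat_numeral)
  also have "\<dots> = (\<Sum>n\<in>{0, 1, 2, 3, 4, 5, 6, 7}. if even n then 0 else x ^ n /\<^sub>R fact n)"
    by (simp add: fact_numeral)
  also have "{0, 1, 2, 3, 4, 5, 6, 7} = {..<8::nat}" by auto
  also have "(\<Sum>n<8. if even n then 0 else x ^ n /\<^sub>R fact n) \<le> (\<Sum>n. if even n then 0 else x ^ n /\<^sub>R fact n)"
    using sinh_converges[of x] assms by (intro sum_le_suminf) (auto simp: sums_iff)
  also have "\<dots> = sinh x" using sinh_converges[of x] by (simp add: sums_iff)
  finally show ?thesis by (simp add: power2_eq_square)
qed

lemma abs_sinh_Re_le_norm_sinh: "\<bar>sinh (Re z)\<bar> \<le> norm (sinh z)"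
proof -
  have "sinh (Re z) ^ 2 \<le> sinh (Re z) ^ 2 + sin (Im z) ^ 2" by simp
  also have "\<dots> = norm (sinh z) ^ 2"
    unfolding cmod_power2 sinh_Re sinh_Im power_mult_distrib cosh_square_eq cos_squared_eq
    by (simp add: algebra_simps)
  finally show ?thesis using abs_le_square_iff[of "sinh (Re z)" "norm (sinh z)"] by simp
qed

lemma edge_norm_sinh_minus:
  assumes e: "e = apex \<or> e = - apex" and x: "x \<in> {0<..1}"
  defines "t \<equiv> 2 * pi * \<i> + of_real x * (e - 2 * pi * \<i>)"
  shows "2 * pi < norm (sinh t - t)"
proof -
  define v where "v = 2 * pi * x"
  have v: "0 < v" using x by (simp add: v_def)
  have t: "\<bar>Re t\<bar> = sqrt 3 * v" "Im t = 2 * pi - v"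
    using e x by (auto simp: t_def v_def apex_def algebra_simps abs_mult)
  have s3: "1.73 \<le> sqrt 3" by (rule real_le_rsqrt) (simp add: power2_eq_square)
  \<comment> \<open>Near the critical point the imaginary part alone is large enough. The bound
    \<open>v < (1 + 3 v^2 / 2) (v - v^3 / 6)\<close> behind this holds for \<open>v^2 < 16 / 3\<close>, and from \<open>v = 23 / 10\<close>
    on \<open>|sinh t|\<close> already exceeds \<open>6 \<pi>\<close>.\<close>
  show ?thesis
  proof (cases "v \<le> 23 / 10")
    case True
    have "cosh (Re t) = cosh (sqrt 3 * v)" using t(1) by (metis cosh_real_abs)
    moreover have "sin (Im t) = - sin v" unfolding t(2) by (simp add: sin_diff)
    ultimately have "Im (sinh t - t) = - (cosh (sqrt 3 * v) * sin v) - 2 * pi + v"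
      by (simp add: sinh_Im t(2))
    moreover have "v < cosh (sqrt 3 * v) * sin v"
    proof -
      have "v ^ 2 \<le> (23 / 10) ^ 2" using True v by (intro power_mono) auto
      then have "0 < v ^ 3 * (4 / 3 - v ^ 2 / 4)"
        using v by (intro mult_pos_pos) (auto simp: power2_eq_square)
      then have "v < (1 + (sqrt 3 * v) ^ 2 / 2) * (v - v ^ 3 / 6)"
        by (simp add: algebra_simps power2_eq_square power3_eq_cube)
      also have "\<dots> \<le> cosh (sqrt 3 * v) * sin v"
        using True v \<open>v ^ 2 \<le> _\<close> by (intro mult_mono cosh_quadratic_lower sin_cubic_lower)
          (auto simp: power2_eq_square power3_eq_cube)
      finally show ?thesis .
    qed
    ultimately have "2 * pi < - Im (sinh t - t)" by simp
    also have "\<dots> \<le> norm (sinh t - t)" using abs_Im_le_cmod[of "sinh t - t"] by linarith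
    finally show ?thesis .
  next
    case False
    have "1.73 * 2.3 \<le> sqrt 3 * v" using False s3 by (intro mult_mono) auto
    then have "24 < sinh (sqrt 3 * v)" by (intro sinh_large) simp
    also have "\<dots> = \<bar>sinh (Re t)\<bar>" by (simp flip: t(1))
    also have "\<dots> \<le> norm (sinh t)" by (rule abs_sinh_Re_le_norm_sinh)
    finally have "24 < norm (sinh t)" .
    moreover have "norm t < 4 * pi"
      using x by (intro edge_point(4)[OF e])
        (auto simp: closed_segment_def t_def scaleR_conv_of_real algebra_simps intro!: exI[of _ x])
    ultimately show ?thesis
      using norm_triangle_ineq2[of "sinh t" t] pi_less_4 by linarith
  qed
qed

text \<open>
  A branch of the logarithm of \<open>\<i> (sinh t - t) / (2 \<pi>)\<close> that vanishes at \<open>2 \<pi> \<i>\<close>. The principal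
  logarithm would not do, as the argument leaves the slit plane along the sides.
\<close>

definition saddle_exponent :: "complex \<Rightarrow> complex" where
  "saddle_exponent t = 3 * Ln (- \<i> * t) - log_B_base t - of_real (ln (12 * pi))"

lemma exp_saddle_exponent:
  assumes "t \<in> strip" "t \<noteq> 0"
  shows "exp (saddle_exponent t) = \<i> * (sinh t - t) / (2 * pi)"
proof -
  have "exp (3 * Ln (- \<i> * t)) = (- \<i> * t) ^ 3"
    using assms by (simp only: exp_of_nat_mult[of 3, simplified]) simp
  also have "\<dots> = \<i> * t ^ 3" by (simp add: power3_eq_cube mult_ac)
  finally show ?thesis
    using assms sinh_ne_id_in_strip[OF assms]
    by (simp add: saddle_exponent_def exp_diff exp_add exp_log_B_base B_base_def exp_of_real field_simps)
qed

text \<open>The normalisation works because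
  \<open>(2 \<pi>)^3 = (2 \<pi>^2 / 3) * (12 \<pi>)\<close>. This is where the factor
  \<open>12 \<pi>\<close> of the theorem originates: it is \<open>6 |sinh t - t|\<close> at the
  saddle.\<close>

lemma saddle_exponent_saddle: "saddle_exponent (2 * pi * \<i>) = 0"
proof -
  have "Ln (- \<i> * (2 * pi * \<i>)) = of_real (ln (2 * pi))"
  proof -
    have "- \<i> * (2 * pi * \<i>) = of_real (2 * pi)" by simp
    then show ?thesis using Ln_of_real[of "2 * pi"] by (simp only:) simp
  qed
  moreover have "3 * complex_of_real (ln (2 * pi)) - of_real (ln (2 * pi ^ 2 / 3)) - of_real (ln (12 * pi)) = 0"
  proof -
    have "3 * ln (2 * pi) = ln ((2 * pi) ^ 3)" using ln_realpow[of "2 * pi" 3] by (simp del: power_mult_distrib)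
    also have "(2 * pi) ^ 3 = (2 * pi ^ 2 / 3) * (12 * pi)" by (simp add: eval_nat_numeral)
    also have "ln \<dots> = ln (2 * pi ^ 2 / 3) + ln (12 * pi)" by (rule ln_mult_pos) auto
    finally have "complex_of_real (3 * ln (2 * pi)) = of_real (ln (2 * pi ^ 2 / 3) + ln (12 * pi))"
      by (simp only:)
    then show ?thesis by (simp only: of_real_mult of_real_add of_real_numeral) simp
  qed
  ultimately show ?thesis unfolding saddle_exponent_def log_B_base_saddle by (simp only:)
qed

lemma saddle_exponent_continuous:
  assumes "e = apex \<or> e = - apex"
  shows "continuous_on (closed_segment (2 * pi * \<i>) e) saddle_exponent"
  unfolding saddle_exponent_def
  using edge_point[OF assms] rotated_not_nonpos_Reals
  by (intro continuous_intros continuous_on_subset[OF holomorphic_on_imp_continuous_on[OF log_B_base_holomorphic]])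
     auto

lemma edge_in_segment:
  "x \<in> {0..1} \<Longrightarrow> a + of_real x * (e - a) \<in> closed_segment a e" for a e :: complex
  by (auto simp: closed_segment_def scaleR_conv_of_real algebra_simps intro!: exI[of _ x])

lemma saddle_exponent_edge_continuous:
  assumes "e = apex \<or> e = - apex"
  shows "continuous_on {0..1} (\<lambda>x. saddle_exponent (2 * pi * \<i> + of_real x * (e - 2 * pi * \<i>)))"
  by (rule continuous_on_compose2[OF saddle_exponent_continuous[OF assms]])
     (auto intro!: continuous_intros edge_in_segment)

lemma saddle_exponent_edge_pos:
  assumes e: "e = apex \<or> e = - apex" and x: "x \<in> {0<..1}"
  shows "0 < Re (saddle_exponent (2 * pi * \<i> + of_real x * (e - 2 * pi * \<i>)))"
proof -
  let ?t = "2 * pi * \<i> + of_real x * (e - 2 * pi * \<i>)"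
  have t: "?t \<in> strip" "?t \<noteq> 0"
    using edge_point[OF e edge_in_segment[of x]] x by auto
  have "1 < norm (exp (saddle_exponent ?t))"
    unfolding exp_saddle_exponent[OF t] using edge_norm_sinh_minus[OF e x]
    by (simp add: norm_mult norm_divide)
  then show ?thesis by simp
qed

lemma edge_direction_cube:
  assumes "e = apex \<or> e = - apex"
  shows "\<i> * (e - 2 * pi * \<i>) ^ 3 = of_real ((4 * pi) ^ 3)"
proof -
  have s: "of_real (sqrt 3) * of_real (sqrt 3) = (3 :: complex)"
    by (simp flip: of_real_mult)
  show ?thesis using assms s
    by (auto simp: complex_eq_iff apex_def power3_eq_cube algebra_simps)
qed

text \<open>As \<open>E\<close> tends to \<open>0\<close>, it may be replaced by
  \<open>exp E - 1\<close>, which by periodicity of \<open>sinh\<close> equals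
  \<open>\<i> (sinh w - w) / (2 \<pi>)\<close> with \<open>w = x * d\<close>. Its cubic coefficient
  is \<open>\<i> d^3 / (12 \<pi>) = (4 \<pi>)^3 / (12 \<pi>)\<close>.\<close>

lemma saddle_exponent_edge_limit:
  assumes e: "e = apex \<or> e = - apex"
  shows "((\<lambda>x. saddle_exponent (2 * pi * \<i> + of_real x * (e - 2 * pi * \<i>)) / of_real x ^ 3)
           \<longlongrightarrow> of_real (16 * pi ^ 2 / 3)) (at_right 0)"
proof -
  define d where "d = e - 2 * pi * \<i>"
  define E where "E x = saddle_exponent (2 * pi * \<i> + of_real x * d)" for x
  have ev: "\<forall>\<^sub>F x in at_right (0::real). x \<in> {0<..1}"
    by (auto simp: eventually_at intro!: exI[of _ 1])
  have d0: "d \<noteq> 0" using edge_direction_cube[OF e] unfolding d_def by auto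
  have E_ne: "E x \<noteq> 0" if "x \<in> {0<..1}" for x
    using saddle_exponent_edge_pos[OF e that] unfolding E_def d_def by auto
  have "continuous_on {0..1} E"
    using saddle_exponent_edge_continuous[OF e] by (simp add: E_def[abs_def] d_def)
  then have "(E \<longlongrightarrow> E 0) (at 0 within {0..1})" by (simp only: continuous_on_def) simp
  then have "(E \<longlongrightarrow> E 0) (at_right 0)" by (simp add: at_within_Icc_at_right)
  moreover have "E 0 = 0" using saddle_exponent_saddle by (simp add: E_def)
  ultimately have "(E \<longlongrightarrow> 0) (at_right 0)" by simp
  then have E_lim: "filterlim E (at 0) (at_right 0)"
    unfolding filterlim_at using eventually_mono[OF ev E_ne] by auto
  have "((\<lambda>w::complex. (exp w - 1) / w) \<longlongrightarrow> 1) (at 0)"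
    using DERIV_exp[of "0::complex"] by (simp add: DERIV_def)
  from filterlim_compose[OF this E_lim]
  have 1: "((\<lambda>x. (exp (E x) - 1) / E x) \<longlongrightarrow> 1) (at_right 0)" .
  have d_lim: "filterlim (\<lambda>x. of_real x * d) (at 0) (at_right 0)"
    unfolding filterlim_at
  proof
    have "((\<lambda>x. of_real x * d) \<longlongrightarrow> of_real 0 * d) (at_right 0)"
      by (intro tendsto_intros)
    then show "((\<lambda>x. of_real x * d) \<longlongrightarrow> 0) (at_right 0)" by simp
    show "\<forall>\<^sub>F x in at_right 0. of_real x * d \<in> UNIV \<and> of_real x * d \<noteq> 0"
      using ev by (rule eventually_mono) (use d0 in auto)
  qed
  have lim: "((\<lambda>x. \<i> * d ^ 3 / (2 * pi) * ((sinh (of_real x * d) - of_real x * d) / (of_real x * d) ^ 3))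
          \<longlongrightarrow> \<i> * d ^ 3 / (2 * pi) * (1 / 6)) (at_right 0)"
    by (intro tendsto_intros filterlim_compose[OF sinh_sub_id_limit d_lim])
  define E' where "E' = (\<lambda>x. \<i> * d ^ 3 / (2 * pi) *
      ((sinh (of_real x * d) - of_real x * d) / (of_real x * d) ^ 3) / ((exp (E x) - 1) / E x))"
  from tendsto_divide[OF lim 1]
  have "((\<lambda>x. \<i> * d ^ 3 / (2 * pi) * ((sinh (of_real x * d) - of_real x * d) / (of_real x * d) ^ 3)
            / ((exp (E x) - 1) / E x)) \<longlongrightarrow> \<i> * d ^ 3 / (2 * pi) * (1 / 6)) (at_right 0)"
    by simp
  also have "\<i> * d ^ 3 / (2 * pi) * (1 / 6) = of_real (16 * pi ^ 2 / 3)"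
    unfolding d_def edge_direction_cube[OF e] by (simp add: eval_nat_numeral)
  finally have "(E' \<longlongrightarrow> of_real (16 * pi ^ 2 / 3)) (at_right 0)" unfolding E'_def .
  moreover have "\<forall>\<^sub>F x in at_right 0. E' x = E x / of_real x ^ 3"
    using ev
  proof eventually_elim
    case (elim x)
    have t: "2 * pi * \<i> + of_real x * d \<in> strip" "2 * pi * \<i> + of_real x * d \<noteq> 0"
      using edge_point[OF e edge_in_segment[of x]] elim by (auto simp: d_def)
    have "sinh (2 * pi * \<i> + of_real x * d) = sinh (of_real x * d)"
    proof -
      have "exp (2 * pi * \<i> + w) = exp w" "exp (- (2 * pi * \<i> + w)) = exp (- w)" for w
        by (simp_all add: exp_add exp_diff exp_minus inverse_eq_divide)
      then show ?thesis unfolding sinh_field_def by (simp only:)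
    qed
    moreover have "\<i> * (s - (2 * pi * \<i> + w)) / (2 * pi) - 1 = \<i> * (s - w) / (2 * pi)"
      for s w :: complex
    proof -
      have "\<i> * (s - (2 * pi * \<i> + w)) = \<i> * (s - w) + 2 * pi" by (simp add: algebra_simps)
      then show ?thesis by (simp only: add_divide_distrib) simp
    qed
    ultimately have q: "exp (E x) - 1 = \<i> * (sinh (of_real x * d) - of_real x * d) / (2 * pi)"
      unfolding E_def exp_saddle_exponent[OF t] by (simp only:)
    have "exp (E x) \<noteq> 1"
    proof
      assume "exp (E x) = 1"
      then have "norm (exp (E x)) = 1" by simp
      with saddle_exponent_edge_pos[OF e elim] show False by (simp add: E_def d_def)
    qed
    with q have "sinh (of_real x * d) - of_real x * d \<noteq> 0" by auto
    then show ?case unfolding E'_def q using E_ne[OF elim] elim d0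
      by (simp add: power_mult_distrib)
  qed
  ultimately have "((\<lambda>x. E x / of_real x ^ 3) \<longlongrightarrow> of_real (16 * pi ^ 2 / 3)) (at_right 0)"
    by (rule Lim_transform_eventually)
  then show ?thesis by (simp add: E_def d_def)
qed

section \<open>Splitting into cosine and sine terms\<close>

text \<open>The side is parametrised from the saddle and \<open>F\<close> sees only the displacement
  from it, the phase at the saddle being split off. The constant factor \<open>dt/dx\<close> stays
  outside.\<close>

definition edge_integral :: "(complex \<Rightarrow> complex) \<Rightarrow> complex \<Rightarrow> nat \<Rightarrow> complex \<Rightarrow> complex" where
  "edge_integral F \<kappa> n e = integral {0..1} (\<lambda>x. F (\<kappa> * (of_real x * (e - 2 * pi * \<i>))) *
     exp (- (of_real ((real n + 1) / 3) * saddle_exponent (2 * pi * \<i> + of_real x * (e - 2 * pi * \<i>)))))"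

lemma cos_sin_cosh_sinh_exp:
  "2 * (cos \<theta> * cosh w + \<i> * sin \<theta> * sinh w) = exp (\<i> * \<theta>) * exp w + exp (- (\<i> * \<theta>)) * exp (- w)"
  for \<theta> w :: complex
  by (simp add: cos_exp_eq sin_exp_eq sinh_field_def cosh_field_def field_simps)

text \<open>Here \<open>(- \<i>) ^ n\<close> is \<open>exp (- \<i> \<pi> n / 2)\<close> and
  \<open>(- \<i>) ^ n * (- 1) ^ n\<close> is its inverse, so the two exponentials become
  \<open>exp (\<plusminus> (\<i> \<theta> + w))\<close>. This is the source of the phase
  \<open>- \<pi> n / 2\<close>.\<close>

lemma power_ii_exp:
  fixes \<kappa> w :: complex
  shows "(- \<i>) ^ n * (exp (2 * pi * \<i> * \<kappa> + w) + (- 1) ^ n * exp (- (2 * pi * \<i> * \<kappa> + w))) =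
     2 * (cos (2 * pi * \<kappa> - of_real (pi / 2) * of_nat n) * cosh w +
          \<i> * sin (2 * pi * \<kappa> - of_real (pi / 2) * of_nat n) * sinh w)"
proof -
  let ?\<theta> = "2 * pi * \<kappa> - of_real (pi / 2) * of_nat n"
  have "exp (of_nat n * (- (\<i> * of_real (pi / 2)))) = exp (- (\<i> * of_real (pi / 2))) ^ n"
    by (rule exp_of_nat_mult)
  also have "exp (- (\<i> * of_real (pi / 2))) = - \<i>"
    by (simp add: complex_eq_iff Re_exp Im_exp)
  finally have 1: "exp (of_nat n * (- (\<i> * of_real (pi / 2)))) = (- \<i>) ^ n" .
  have "exp (of_nat n * (\<i> * of_real (pi / 2))) = exp (\<i> * of_real (pi / 2)) ^ n"
    by (rule exp_of_nat_mult)
  also have "exp (\<i> * of_real (pi / 2)) = \<i>"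
    by (simp add: complex_eq_iff Re_exp Im_exp)
  also have "\<i> ^ n = ((- \<i>) * (- 1)) ^ n" by simp
  finally have 2: "exp (of_nat n * (\<i> * of_real (pi / 2))) = (- \<i>) ^ n * (- 1) ^ n"
    by (simp only: power_mult_distrib)
  have "\<i> * ?\<theta> = 2 * pi * \<i> * \<kappa> + of_nat n * (- (\<i> * of_real (pi / 2)))"
    and "- (\<i> * ?\<theta>) = - (2 * pi * \<i> * \<kappa>) + of_nat n * (\<i> * of_real (pi / 2))"
    by (simp_all add: algebra_simps)
  then have "exp (\<i> * ?\<theta>) = exp (2 * pi * \<i> * \<kappa>) * (- \<i>) ^ n"
    and "exp (- (\<i> * ?\<theta>)) = exp (- (2 * pi * \<i> * \<kappa>)) * ((- \<i>) ^ n * (- 1) ^ n)"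
    by (simp_all only: exp_add 1 2)
  then show ?thesis
    unfolding cos_sin_cosh_sinh_exp by (simp add: exp_add exp_diff exp_minus field_simps)
qed

text \<open>No branch ambiguity arises: \<open>3 * s\<close> is the integer \<open>n + 1\<close>, so
  the logarithm of \<open>- \<i> * t\<close> enters through an honest power.\<close>

lemma exp_log_B_base_over_power:
  fixes n :: nat
  assumes "0 \<le> Im t" "t \<noteq> 0"
  defines "s \<equiv> complex_of_real ((real n + 1) / 3)"
  shows "exp (s * log_B_base t) / t ^ Suc n =
    (- \<i>) ^ Suc n * of_real ((12 * pi) powr (- ((real n + 1) / 3))) * exp (- (s * saddle_exponent t))"
proof -
  have s3: "s * 3 = of_nat (Suc n)" by (simp add: s_def)
  have "- (s * saddle_exponent t) =
      s * log_B_base t + s * of_real (ln (12 * pi)) - (s * 3) * Ln (- \<i> * t)"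
    by (simp add: saddle_exponent_def algebra_simps)
  then have "exp (- (s * saddle_exponent t)) =
      exp (s * log_B_base t) * exp (s * of_real (ln (12 * pi))) / exp (of_nat (Suc n) * Ln (- \<i> * t))"
    by (simp only: exp_diff exp_add s3)
  also have "exp (of_nat (Suc n) * Ln (- \<i> * t)) = (- \<i> * t) ^ Suc n"
    unfolding exp_of_nat_mult using assms by (subst exp_Ln) auto
  also have "exp (s * of_real (ln (12 * pi))) = of_real ((12 * pi) powr ((real n + 1) / 3))"
    by (simp only: s_def of_real_mult[symmetric] exp_of_real) (simp add: powr_def)
  finally show ?thesis
    using assms unfolding power_mult_distrib by (simp add: powr_minus field_simps)
qed

text \<open>The prefactor \<open>- K / pi\<close> collects \<open>- \<i>\<close> from
  \<open>(- \<i>) ^ Suc n\<close>, the 2 of \<open>power_ii_exp\<close> and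
  \<open>1 / (2 \<pi> \<i>)\<close> from the residue theorem. No error term appears, so the phases
  are exact for every \<open>n\<close>.\<close>

lemma B_edge_integrals:
  fixes \<kappa> :: complex and n :: nat
  defines "\<theta> \<equiv> \<lambda>n. 2 * complex_of_real pi * \<kappa> - complex_of_real (pi / 2) * of_nat n"
  shows "B n \<kappa> = - of_real ((12 * pi) powr (- ((real n + 1) / 3)) / pi) *
    (cos (\<theta> n) * ((- apex - 2 * pi * \<i>) * edge_integral cosh \<kappa> n (- apex)
                 - (apex - 2 * pi * \<i>) * edge_integral cosh \<kappa> n apex)
     + \<i> * sin (\<theta> n) * ((- apex - 2 * pi * \<i>) * edge_integral sinh \<kappa> n (- apex)
                 - (apex - 2 * pi * \<i>) * edge_integral sinh \<kappa> n apex))"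
proof -
  define s where "s = complex_of_real ((real n + 1) / 3)"
  define K where "K = complex_of_real ((12 * pi) powr (- ((real n + 1) / 3)))"
  define f where "f t = exp (\<kappa> * t) * exp (s * log_B_base t)" for t
  define \<Psi> where "\<Psi> t = - (2 * \<i> * K) *
      (cos (\<theta> n) * cosh (\<kappa> * (t - 2 * pi * \<i>)) + \<i> * sin (\<theta> n) * sinh (\<kappa> * (t - 2 * pi * \<i>))) *
      exp (- (s * saddle_exponent t))" for t
  have f: "f holomorphic_on strip"
    unfolding f_def by (intro holomorphic_intros log_B_base_holomorphic)
  have f_\<Psi>: "f t / t ^ Suc n - f (- t) / (- t) ^ Suc n = \<Psi> t" if t: "t \<in> path_image half_rhombus" for t
  proof -
    note t = half_rhombus_point[OF t]
    define w where "w = \<kappa> * (t - 2 * pi * \<i>)"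
    have \<kappa>t: "\<kappa> * t = 2 * pi * \<i> * \<kappa> + w" by (simp add: w_def algebra_simps)
    have "(- t) ^ Suc n = - ((- 1) ^ n * t ^ Suc n)"
      by (simp add: power_minus[of t])
    then have "f t / t ^ Suc n - f (- t) / (- t) ^ Suc n =
        (exp (s * log_B_base t) / t ^ Suc n) * (exp (\<kappa> * t) + (- 1) ^ n * exp (- (\<kappa> * t)))"
      using t by (cases "even n") (simp_all add: f_def log_B_base_even field_simps)
    also have "\<dots> = (- \<i>) ^ Suc n * K * exp (- (s * saddle_exponent t)) * (exp (\<kappa> * t) + (- 1) ^ n * exp (- (\<kappa> * t)))"
      unfolding s_def K_def exp_log_B_base_over_power[OF t(2,3)] ..
    also have "\<dots> = - \<i> * K * exp (- (s * saddle_exponent t)) *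
        ((- \<i>) ^ n * (exp (\<kappa> * t) + (- 1) ^ n * exp (- (\<kappa> * t))))"
      by (simp only: power_Suc mult_ac)
    also have "\<dots> = \<Psi> t"
      unfolding \<kappa>t power_ii_exp by (simp add: \<Psi>_def w_def \<theta>_def)
    finally show ?thesis .
  qed
  have \<Psi>_cont: "continuous_on (closed_segment (2 * pi * \<i>) e) \<Psi>" if "e = apex \<or> e = - apex" for e
    unfolding \<Psi>_def by (intro continuous_intros saddle_exponent_continuous that)
  have \<Psi>_cont': "continuous_on (closed_segment apex (2 * pi * \<i>)) \<Psi>"
    by (subst closed_segment_commute, rule \<Psi>_cont) simp
  have edge: "contour_integral (linepath (2 * pi * \<i>) e) \<Psi> =
      - (2 * \<i> * K) * (e - 2 * pi * \<i>) *
      (cos (\<theta> n) * edge_integral cosh \<kappa> n e + \<i> * sin (\<theta> n) * edge_integral sinh \<kappa> n e)"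
    if e: "e = apex \<or> e = - apex" for e
  proof -
    define d where "d = e - 2 * pi * \<i>"
    define g where "g F x = F (\<kappa> * (of_real x * d)) * exp (- (s * saddle_exponent (2 * pi * \<i> + of_real x * d)))"
      for F :: "complex \<Rightarrow> complex" and x
    have int: "g F integrable_on {0..1}" if "continuous_on UNIV F" for F
      unfolding g_def[abs_def] d_def
      by (intro integrable_continuous_real continuous_intros saddle_exponent_edge_continuous[OF e]
          continuous_on_compose2[OF that]) auto
    have "contour_integral (linepath (2 * pi * \<i>) e) \<Psi> =
        integral {0..1} (\<lambda>x. \<Psi> (linepath (2 * pi * \<i>) e x) * d)"
      by (simp add: contour_integral_integral vector_derivative_linepath_at d_def)
    also have "\<dots> = integral {0..1} (\<lambda>x. - (2 * \<i> * K) * d *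
        (cos (\<theta> n) * g cosh x + \<i> * sin (\<theta> n) * g sinh x))"
    proof (rule integral_cong)
      fix x :: real
      have "linepath (2 * pi * \<i>) e x = 2 * pi * \<i> + of_real x * d"
        by (simp add: linepath_def d_def scaleR_conv_of_real algebra_simps)
      then show "\<Psi> (linepath (2 * pi * \<i>) e x) * d =
          - (2 * \<i> * K) * d * (cos (\<theta> n) * g cosh x + \<i> * sin (\<theta> n) * g sinh x)"
        by (simp add: \<Psi>_def g_def algebra_simps)
    qed
    also have "\<dots> = - (2 * \<i> * K) * d *
        (cos (\<theta> n) * integral {0..1} (g cosh) + \<i> * sin (\<theta> n) * integral {0..1} (g sinh))"
      by (intro integral_unique has_integral_mult_right has_integral_add integrable_integral int continuous_intros)
    finally show ?thesis
      by (simp add: edge_integral_def g_def[abs_def] d_def s_def)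
  qed
  have "B n \<kappa> = (deriv ^^ n) f 0 / fact n"
    unfolding B_eq_deriv_log_B_base f_def[abs_def] s_def ..
  also have "\<dots> = 1 / (2 * pi * \<i>) * contour_integral half_rhombus (\<lambda>t. f t / t ^ Suc n - f (- t) / (- t) ^ Suc n)"
    by (rule higher_deriv_half_rhombus[OF f])
  also have "contour_integral half_rhombus (\<lambda>t. f t / t ^ Suc n - f (- t) / (- t) ^ Suc n) =
      contour_integral half_rhombus \<Psi>"
    by (rule contour_integral_cong[OF refl f_\<Psi>])
  also have "\<dots> = contour_integral (linepath apex (2 * pi * \<i>)) \<Psi> + contour_integral (linepath (2 * pi * \<i>) (- apex)) \<Psi>"
    unfolding half_rhombus_def
    by (intro contour_integral_join contour_integrable_continuous_linepath \<Psi>_cont \<Psi>_cont') simp_all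
  \<comment> \<open>Reversing the first side makes both start at the saddle, as the Laplace estimate
    requires; hence the differences in the result.\<close>
  also have "contour_integral (linepath apex (2 * pi * \<i>)) \<Psi> = - contour_integral (linepath (2 * pi * \<i>) apex) \<Psi>"
    by (rule contour_integral_reverse_linepath[OF \<Psi>_cont'])
  also have "1 / (2 * pi * \<i>) * (- contour_integral (linepath (2 * pi * \<i>) apex) \<Psi> + contour_integral (linepath (2 * pi * \<i>) (- apex)) \<Psi>)
     = - (K / pi) *
    (cos (\<theta> n) * ((- apex - 2 * pi * \<i>) * edge_integral cosh \<kappa> n (- apex)
                 - (apex - 2 * pi * \<i>) * edge_integral cosh \<kappa> n apex)
     + \<i> * sin (\<theta> n) * ((- apex - 2 * pi * \<i>) * edge_integral sinh \<kappa> n (- apex)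
                 - (apex - 2 * pi * \<i>) * edge_integral sinh \<kappa> n apex))"
    unfolding edge[OF disjI1, OF refl] edge[OF disjI2, OF refl]
    by (simp add: divide_simps) (simp add: algebra_simps)
  finally show ?thesis by (simp add: K_def)
qed

section \<open>Combining the two terms\<close>

text \<open>Where \<open>c n\<close> vanishes only the second terms remain, and their ratio tends to
  1, or both are zero if \<open>\<kappa> = 0\<close>. Elsewhere \<open>|c n| \<ge> m\<close>, so the
  first term dominates and absorbs both errors. The proof bounds the difference by
  \<open>\<epsilon>\<close> times the target and never divides by the target, which may be
  zero.\<close>

lemma two_term_asymp_equiv:
  fixes a b A B' c s :: "nat \<Rightarrow> complex" and \<kappa> :: complex
  assumes nz: "\<And>n. A n \<noteq> 0" "\<And>n. B' n \<noteq> 0"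
    and a: "(\<lambda>n. a n / A n) \<longlonglongrightarrow> 1"
    and b: "(\<lambda>n. b n / B' n) \<longlonglongrightarrow> \<kappa>" and b0: "\<And>n. \<kappa> = 0 \<Longrightarrow> b n = 0"
    and AB: "(\<lambda>n. B' n / A n) \<longlonglongrightarrow> 0"
    and s: "\<And>n. norm (s n) \<le> M"
    and c: "0 < m" "\<And>n. c n = 0 \<or> m \<le> norm (c n)"
  shows "(\<lambda>n. a n * c n + b n * s n) \<sim>[sequentially] (\<lambda>n. A n * c n + B' n * \<kappa> * s n)"
proof (rule smallo_imp_asymp_equiv, rule landau_o.smallI)
  fix \<epsilon> :: real assume \<epsilon>: "\<epsilon> > 0"
  have M: "0 \<le> M" using s[of 0] norm_ge_zero[of "s 0"] by linarith
  have "(\<lambda>n. norm (a n / A n - 1)) \<longlonglongrightarrow> norm (1 - 1 :: complex)"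
    by (intro tendsto_intros a)
  \<comment> \<open>The errors allowed here and in \<open>e3\<close>, \<open>\<epsilon> / 4\<close>
    and \<open>\<epsilon> * m / 4\<close>, add up to half of
    \<open>\<epsilon> * |A n * c n|\<close>. The \<open>m / 2\<close> in \<open>e2\<close> keeps the
    second term of the target below half of the first, so the target is at least
    \<open>|A n * c n| / 2\<close>.\<close>
  then have e1: "\<forall>\<^sub>F n in sequentially. norm (a n / A n - 1) < \<epsilon> / 4"
    using \<epsilon> by (intro order_tendstoD(2)) auto
  have "(\<lambda>n. norm \<kappa> * M * norm (B' n / A n)) \<longlonglongrightarrow> norm \<kappa> * M * norm (0 :: complex)"
    by (intro tendsto_intros AB)
  then have e2: "\<forall>\<^sub>F n in sequentially. norm \<kappa> * M * norm (B' n / A n) < m / 2"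
    using c by (intro order_tendstoD(2)) auto
  have "(\<lambda>n. norm (b n / B' n - \<kappa>) * M * norm (B' n / A n)) \<longlonglongrightarrow> norm (\<kappa> - \<kappa>) * M * norm (0 :: complex)"
    by (intro tendsto_intros AB b)
  then have e3: "\<forall>\<^sub>F n in sequentially. norm (b n / B' n - \<kappa>) * M * norm (B' n / A n) < \<epsilon> * m / 4"
    using c \<epsilon> by (intro order_tendstoD(2)) auto
  have e4: "\<forall>\<^sub>F n in sequentially. norm (b n / B' n - \<kappa>) \<le> \<epsilon> * norm \<kappa>"
  proof (cases "\<kappa> = 0")
    case False
    have "(\<lambda>n. norm (b n / B' n - \<kappa>)) \<longlonglongrightarrow> norm (\<kappa> - \<kappa>)" by (intro tendsto_intros b)
    then have "\<forall>\<^sub>F n in sequentially. norm (b n / B' n - \<kappa>) < \<epsilon> * norm \<kappa>"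
      using False \<epsilon> by (intro order_tendstoD(2)) auto
    then show ?thesis by eventually_elim simp
  qed (simp add: b0)
  show "\<forall>\<^sub>F n in sequentially.
      norm (a n * c n + b n * s n - (A n * c n + B' n * \<kappa> * s n)) \<le> \<epsilon> * norm (A n * c n + B' n * \<kappa> * s n)"
    using e1 e2 e3 e4
  proof eventually_elim
    case (elim n)
    have diff: "a n * c n + b n * s n - (A n * c n + B' n * \<kappa> * s n) =
        (a n / A n - 1) * (A n * c n) + (b n / B' n - \<kappa>) * B' n * s n"
      using nz[of n] by (simp add: field_simps)
    show ?case
    proof (cases "c n = 0")
      case True
      have "norm (b n / B' n - \<kappa>) * norm (B' n * s n) \<le> \<epsilon> * norm \<kappa> * norm (B' n * s n)"
        by (intro mult_right_mono elim) auto
      then show ?thesis unfolding diff using True by (simp add: norm_mult mult_ac)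
    next
      case False
      with c have m: "m \<le> norm (c n)" by auto
      define Q where "Q = norm (B' n / A n)"
      have BQ: "norm (B' n) = Q * norm (A n)" using nz[of n] by (simp add: Q_def norm_divide)
      have A0: "0 \<le> norm (A n)" by simp
      have small: "x * norm (B' n) * norm (s n) \<le> norm (A n) * (x * M * Q)" if "0 \<le> x" for x
      proof -
        have "x * norm (B' n) * norm (s n) \<le> x * norm (B' n) * M"
          using that s[of n] by (intro mult_left_mono) auto
        then show ?thesis by (simp add: BQ mult_ac)
      qed
      have "norm (A n) * norm (c n) - norm (A n) * (norm \<kappa> * M * Q)
          \<le> norm (A n * c n) - norm (B' n * \<kappa> * s n)"
        using small[of "norm \<kappa>"] by (simp add: norm_mult mult_ac)
      also have "\<dots> \<le> norm (A n * c n + B' n * \<kappa> * s n)"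
        using norm_diff_triangle_ineq[of "A n * c n" "0" 0 "- (B' n * \<kappa> * s n)"]
          norm_triangle_ineq2[of "A n * c n" "- (B' n * \<kappa> * s n)"] by simp
      finally have g1: "norm (A n) * norm (c n) - norm (A n) * (norm \<kappa> * M * Q)
          \<le> norm (A n * c n + B' n * \<kappa> * s n)" .
      have "norm (A n) * (norm \<kappa> * M * Q) \<le> norm (A n) * (norm (c n) / 2)"
        using elim(2) m unfolding Q_def by (intro mult_left_mono) auto
      with g1 have g: "norm (A n) * norm (c n) / 2 \<le> norm (A n * c n + B' n * \<kappa> * s n)" by simp
      have "norm (a n * c n + b n * s n - (A n * c n + B' n * \<kappa> * s n)) \<le>
          norm (a n / A n - 1) * (norm (A n) * norm (c n)) + norm (b n / B' n - \<kappa>) * norm (B' n) * norm (s n)"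
        unfolding diff by (rule order_trans[OF norm_triangle_ineq]) (simp add: norm_mult)
      also have "\<dots> \<le> \<epsilon> / 4 * (norm (A n) * norm (c n)) + norm (A n) * (\<epsilon> * m / 4)"
      proof (rule add_mono)
        show "norm (a n / A n - 1) * (norm (A n) * norm (c n)) \<le> \<epsilon> / 4 * (norm (A n) * norm (c n))"
          using elim(1) by (intro mult_right_mono) auto
        have "norm (b n / B' n - \<kappa>) * norm (B' n) * norm (s n)
            \<le> norm (A n) * (norm (b n / B' n - \<kappa>) * M * Q)" by (rule small) simp
        also have "\<dots> \<le> norm (A n) * (\<epsilon> * m / 4)"
          using elim(3) unfolding Q_def by (intro mult_left_mono) auto
        finally show "norm (b n / B' n - \<kappa>) * norm (B' n) * norm (s n) \<le> norm (A n) * (\<epsilon> * m / 4)" .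
      qed
      also have "norm (A n) * (\<epsilon> * m / 4) \<le> norm (A n) * (\<epsilon> * norm (c n) / 4)"
        using m \<epsilon> by (intro mult_left_mono) auto
      also have "\<epsilon> / 4 * (norm (A n) * norm (c n)) + norm (A n) * (\<epsilon> * norm (c n) / 4) =
          \<epsilon> * (norm (A n) * norm (c n) / 2)" by (simp add: field_simps)
      also have "\<dots> \<le> \<epsilon> * norm (A n * c n + B' n * \<kappa> * s n)"
        using \<epsilon> g by (intro mult_left_mono) auto
      finally show ?thesis by simp
    qed
  qed
qed

text \<open>Shifting by multiples of \<open>\<pi> / 2\<close> only permutes \<open>cos z\<close> and
  \<open>sin z\<close> up to sign, so just two absolute values occur.\<close>

lemma cos_sin_shift_bounds:
  fixes z :: complex
  defines "\<theta> \<equiv> \<lambda>n::nat. z - of_real (pi / 2) * of_nat n"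
  obtains m M where "0 < m" "\<And>n. cos (\<theta> n) = 0 \<or> m \<le> norm (cos (\<theta> n))" "\<And>n. norm (sin (\<theta> n)) \<le> M"
proof -
  \<comment> \<open>A vanishing value is replaced by 1 so that the minimum below stays
    positive.\<close>
  define bd where "bd w = (if w = 0 then 1 else norm w)" for w :: complex
  have *: "norm (cos (\<theta> n)) = norm (cos z) \<and> norm (sin (\<theta> n)) = norm (sin z) \<or>
      norm (cos (\<theta> n)) = norm (sin z) \<and> norm (sin (\<theta> n)) = norm (cos z)" for n
  proof -
    define k where "k = n div 2"
    define w where "w = complex_of_real (real k * pi)"
    have cs: "cos w = (- 1) ^ k" "sin w = 0"
      unfolding w_def cos_of_real sin_of_real cos_npi sin_npi by simp_all
    show ?thesis
    proof (cases "even n")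
      case True
      then have "\<theta> n = z - w" by (auto simp: \<theta>_def k_def w_def)
      then show ?thesis by (simp add: cos_diff sin_diff cs norm_mult norm_power)
    next
      case False
      then have "n = 2 * k + 1" by (simp add: k_def)
      then have "\<theta> n = z - w - of_real pi / 2"
        by (simp add: \<theta>_def w_def algebra_simps)
      then show ?thesis by (simp add: cos_diff sin_diff cs norm_mult norm_power)
    qed
  qed
  show ?thesis
  proof (rule that[of "min (bd (cos z)) (bd (sin z))" "norm (cos z) + norm (sin z)"])
    show "0 < min (bd (cos z)) (bd (sin z))" by (simp add: bd_def)
    show "cos (\<theta> n) = 0 \<or> min (bd (cos z)) (bd (sin z)) \<le> norm (cos (\<theta> n))" for n
    proof (cases "cos (\<theta> n) = 0")
      case False
      then have "0 < norm (cos (\<theta> n))" by simp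
      then show ?thesis using *[of n] by (auto simp: bd_def min_le_iff_disj)
    qed simp
    show "norm (sin (\<theta> n)) \<le> norm (cos z) + norm (sin z)" for n
      using *[of n] norm_ge_zero[of "cos z"] norm_ge_zero[of "sin z"] by linarith
  qed
qed

text \<open>Laplace's method puts Gamma values into the numerator where the theorem has the
  complementary ones in the denominator; this exchanges them.\<close>

lemma Gamma_third_mult_two_thirds: "Gamma (1 / 3) * Gamma (2 / 3) = 2 * pi / sqrt 3"
proof -
  have "complex_of_real (Gamma (1 / 3) * Gamma (2 / 3)) = Gamma (of_real (1 / 3)) * Gamma (of_real (2 / 3))"
    by (simp only: Gamma_complex_of_real of_real_mult)
  also have "\<dots> = of_real pi / sin (of_real pi * of_real (1 / 3))"
    using Gamma_reflection_complex[of "of_real (1 / 3)"] by simp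
  also have "\<dots> = of_real (pi / sin (pi / 3))"
    by (simp flip: sin_of_real)
  finally have "Gamma (1 / 3) * Gamma (2 / 3) = pi / sin (pi / 3)"
    by (simp only: of_real_eq_iff)
  then show ?thesis by (simp add: sin_60)
qed

section \<open>Limits of the edge integrals\<close>

definition laplace_scale :: "nat \<Rightarrow> real" where
  "laplace_scale n = ((real n + 1) / 3) powr (1 / 3)"

lemma laplace_scale_pos: "0 < laplace_scale n"
  by (simp add: laplace_scale_def)

lemma laplace_scale_cube: "laplace_scale n ^ 3 = (real n + 1) / 3"
  by (simp add: laplace_scale_def powr_powr flip: powr_realpow)

lemma laplace_scale_at_top: "filterlim laplace_scale at_top sequentially"
  unfolding laplace_scale_def by real_asymp

lemma edge_integral_limit:
  assumes e: "e = apex \<or> e = - apex"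
    and F: "continuous_on UNIV F"
    and lim: "((\<lambda>x. F (\<kappa> * (of_real x * (e - 2 * pi * \<i>))) / of_real x ^ k) \<longlongrightarrow> h0) (at_right 0)"
  shows "(\<lambda>n. of_real (laplace_scale n) ^ (k + 1) * edge_integral F \<kappa> n e) \<longlonglongrightarrow>
    h0 * of_real (Gamma ((real k + 1) / 3) / (3 * (16 * pi ^ 2 / 3) powr ((real k + 1) / 3)))"
proof -
  have "(\<lambda>n. of_real (laplace_scale n) ^ (k + 1) * integral {0..1} (\<lambda>x. F (\<kappa> * (of_real x * (e - 2 * pi * \<i>))) *
      exp (- (of_real (laplace_scale n) ^ 3 * saddle_exponent (2 * pi * \<i> + of_real x * (e - 2 * pi * \<i>))))))
    \<longlonglongrightarrow> h0 * of_real (Gamma ((real k + 1) / 3) / (3 * (16 * pi ^ 2 / 3) powr ((real k + 1) / 3)))"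
    by (rule Laplace_cubic[OF _ saddle_exponent_edge_continuous[OF e] saddle_exponent_edge_pos[OF e]
          saddle_exponent_edge_limit[OF e] _ lim laplace_scale_at_top laplace_scale_pos])
       (auto intro!: continuous_on_compose2[OF F] continuous_intros)
  then show ?thesis unfolding edge_integral_def of_real_power[symmetric] laplace_scale_cube .
qed

lemma edge_integral_cosh_limit:
  assumes e: "e = apex \<or> e = - apex"
  shows "(\<lambda>n. of_real (laplace_scale n) * edge_integral cosh \<kappa> n e) \<longlonglongrightarrow>
    of_real (Gamma (1 / 3) / (3 * (16 * pi ^ 2 / 3) powr (1 / 3)))"
proof -
  let ?d = "e - 2 * pi * \<i>"
  have "((\<lambda>x. cosh (\<kappa> * (of_real x * ?d))) \<longlongrightarrow> cosh (\<kappa> * (of_real 0 * ?d))) (at_right 0)"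
    by (intro tendsto_intros)
  then show ?thesis
    using edge_integral_limit[OF e, of cosh \<kappa> 0 1] by (simp add: continuous_intros)
qed

text \<open>The linear term of \<open>sinh\<close> gives the case \<open>k = 1\<close> of the
  Laplace lemma, with its slope \<open>\<kappa> * (e - 2 \<pi> \<i>)\<close> as constant.\<close>

lemma edge_integral_sinh_limit:
  assumes e: "e = apex \<or> e = - apex"
  shows "(\<lambda>n. of_real (laplace_scale n) ^ 2 * edge_integral sinh \<kappa> n e) \<longlonglongrightarrow>
    \<kappa> * (e - 2 * pi * \<i>) * of_real (Gamma (2 / 3) / (3 * (16 * pi ^ 2 / 3) powr (2 / 3)))"
proof -
  let ?d = "\<kappa> * (e - 2 * pi * \<i>)"
  have "((\<lambda>z. sinh (z * ?d)) has_field_derivative ?d) (at 0)"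
    by (auto intro!: derivative_eq_intros)
  then have "((\<lambda>z. sinh (z * ?d) / z) \<longlongrightarrow> ?d) (at 0)"
    by (simp add: DERIV_def)
  moreover have "filterlim of_real (at (0::complex)) (at_right (0::real))"
    unfolding filterlim_at
  proof
    show "(of_real \<longlongrightarrow> (0::complex)) (at_right (0::real))"
      using tendsto_of_real[OF tendsto_ident_at[of 0 "{0::real<..}"], where 'a = complex] by simp
  qed (auto simp: eventually_at intro!: exI[of _ 1])
  ultimately have "((\<lambda>x. sinh (of_real x * ?d) / of_real x) \<longlongrightarrow> ?d) (at_right 0)"
    by (rule filterlim_compose)
  then have "((\<lambda>x. sinh (\<kappa> * (of_real x * (e - 2 * pi * \<i>))) / of_real x ^ 1) \<longlongrightarrow> ?d) (at_right 0)"
    by (simp add: mult_ac)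
  from edge_integral_limit[OF e _ this] show ?thesis
    by (simp add: continuous_intros numeral_2_eq_2)
qed

lemma edge_integral_sinh_0: "edge_integral sinh 0 n e = 0"
  by (simp add: edge_integral_def)

section \<open>Matching the constants with those of the theorem\<close>

definition cos_term_coeff :: "nat \<Rightarrow> real" where
  "cos_term_coeff n = (2/3) powr (2/3) / (Gamma (2/3) * (real n / 2 + 1/3) powr (1/3) * (12 * pi) powr (real n / 3))"

definition sin_term_coeff :: "nat \<Rightarrow> real" where
  "sin_term_coeff n = (2/3) powr (1/3) / (Gamma (1/3) * (real n / 2 + 1/3) powr (2/3) * (12 * pi) powr ((real n - 1) / 3))"

text \<open>The Laplace parameter is \<open>(n + 1) / 3\<close> while the theorem uses
  \<open>n / 2 + 1 / 3\<close>; the factor \<open>3 / 2\<close> between them accounts for the powers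
  of \<open>2 / 3\<close>.\<close>

lemma index_ratio_limit:
  "(\<lambda>n. ((real n / 2 + 1/3) / ((real n + 1) / 3)) powr p) \<longlonglongrightarrow> (3 / 2) powr p"
proof -
  have "(real n / 2 + 1/3) / ((real n + 1) / 3) = 3 / 2 - 1 / 2 * inverse (real (Suc n))" for n
    by (simp add: field_simps)
  moreover have "(\<lambda>n. (3 / 2 - 1 / 2 * inverse (real (Suc n))) powr p) \<longlonglongrightarrow> (3 / 2 - 1 / 2 * 0) powr p"
    by (intro tendsto_intros LIMSEQ_inverse_real_of_nat) auto
  ultimately show ?thesis by simp
qed

lemma Gamma_third_nonzero: "Gamma (1 / 3 :: real) \<noteq> 0" "Gamma (2 / 3 :: real) \<noteq> 0"
  using Gamma_real_pos[of "1 / 3"] Gamma_real_pos[of "2 / 3"] by linarith+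

lemma cube_root_facts:
  fixes x :: real
  shows "(12 * pi) powr (1 / 3) * (16 * pi ^ 2 / 3) powr (1 / 3) = 4 * pi"
  "x > 0 \<Longrightarrow> x powr (2 / 3) = (x powr (1 / 3)) ^ 2"
  "((2 / 3) powr (1 / 3)) ^ 3 = (2 / 3 :: real)"
  "(3 / 2) powr (1 / 3) = 1 / (2 / 3 :: real) powr (1 / 3)"
proof -
  have "(12 * pi) powr (1 / 3) * (16 * pi ^ 2 / 3) powr (1 / 3) = ((12 * pi) * (16 * pi ^ 2 / 3)) powr (1 / 3)"
    by (rule powr_mult[symmetric])
  also have "(12 * pi) * (16 * pi ^ 2 / 3) = (4 * pi) powr 3"
    by (simp add: powr_numeral eval_nat_numeral)
  also have "((4 * pi) powr 3) powr (1 / 3) = 4 * pi"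
    unfolding powr_powr by simp
  finally show "(12 * pi) powr (1 / 3) * (16 * pi ^ 2 / 3) powr (1 / 3) = 4 * pi" .
  show "x > 0 \<Longrightarrow> x powr (2 / 3) = (x powr (1 / 3)) ^ 2"
    by (simp add: powr_power)
  show "((2 / 3) powr (1 / 3)) ^ 3 = (2 / 3 :: real)"
    by (simp add: powr_power)
  have "(3 / 2 :: real) powr (1 / 3) * (2 / 3) powr (1 / 3) = (3 / 2 * (2 / 3)) powr (1 / 3)"
    by (rule powr_mult[symmetric])
  then show "(3 / 2) powr (1 / 3) = 1 / (2 / 3 :: real) powr (1 / 3)"
    by (simp add: field_simps)
qed

text \<open>The limit is the reciprocal of what the two sides deliver: the Laplace constant for
  \<open>k = 0\<close> times \<open>4 \<pi> sqrt 3 = 2 * apex\<close>, the difference of the two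
  directions. The product is therefore 1.\<close>

lemma cos_term_coeff_ratio_limit:
  "(\<lambda>n. (12 * pi) powr (- ((real n + 1) / 3)) / (pi * laplace_scale n * cos_term_coeff n)) \<longlonglongrightarrow>
     1 / (Gamma (1 / 3) / (3 * (16 * pi ^ 2 / 3) powr (1 / 3)) * (4 * pi * sqrt 3))"
proof -
  define p q u where "p = (12 * pi) powr (1 / 3)" and "q = (16 * pi ^ 2 / 3) powr (1 / 3)"
    and "u = (2 / 3 :: real) powr (1 / 3)"
  have pos: "0 < p" "0 < q" "0 < u" by (simp_all add: p_def q_def u_def)
  have pq: "p * q = 4 * pi" and u3: "u ^ 3 = 2 / 3"
    using cube_root_facts by (simp_all add: p_def q_def u_def)
  have "(12 * pi) powr (- ((real n + 1) / 3)) / (pi * laplace_scale n * cos_term_coeff n) =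
      Gamma (2 / 3) / (pi * p * u ^ 2) * ((real n / 2 + 1/3) / ((real n + 1) / 3)) powr (1 / 3)" for n
  proof -
    define w where "w = (12 * pi) powr (real n / 3)"
    have "(12 * pi) powr (- ((real n + 1) / 3)) = 1 / (w * p)"
      by (simp only: w_def p_def add_divide_distrib powr_add powr_minus inverse_eq_divide)
    moreover have "((real n / 2 + 1/3) / ((real n + 1) / 3)) powr (1 / 3) =
        (real n / 2 + 1/3) powr (1 / 3) / laplace_scale n"
      unfolding laplace_scale_def by (rule powr_divide)
    moreover have "cos_term_coeff n = u ^ 2 / (Gamma (2 / 3) * (real n / 2 + 1/3) powr (1/3) * w)"
      by (simp add: cos_term_coeff_def u_def w_def cube_root_facts(2))
    ultimately show ?thesis
      using Gamma_third_nonzero pos laplace_scale_pos[of n] by (simp add: w_def)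
  qed
  moreover have "(\<lambda>n. Gamma (2 / 3) / (pi * p * u ^ 2) * ((real n / 2 + 1/3) / ((real n + 1) / 3)) powr (1 / 3))
      \<longlonglongrightarrow> Gamma (2 / 3) / (pi * p * u ^ 2) * (3 / 2) powr (1 / 3)"
    by (intro tendsto_intros index_ratio_limit)
  moreover have "Gamma (2 / 3) / (pi * p * u ^ 2) * (3 / 2) powr (1 / 3) =
      1 / (Gamma (1 / 3) / (3 * q) * (4 * pi * sqrt 3))"
  proof -
    have "Gamma (2 / 3) / (pi * p * u ^ 2) * (3 / 2) powr (1 / 3) = Gamma (2 / 3) / (pi * p * u ^ 3)"
      using pos by (simp add: cube_root_facts(4) flip: u_def) (simp add: eval_nat_numeral)
    also have "\<dots> = 3 * Gamma (2 / 3) / (2 * pi * p)" by (simp add: u3)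
    also have "\<dots> = 3 * q / (Gamma (1 / 3) * (4 * pi * sqrt 3))"
    proof (subst frac_eq_eq)
      have "3 * Gamma (2 / 3) * (Gamma (1 / 3) * (4 * pi * sqrt 3)) = 12 * pi * sqrt 3 * (Gamma (1 / 3) * Gamma (2 / 3))"
        by simp
      also have "\<dots> = 6 * pi * (p * q)" by (simp add: Gamma_third_mult_two_thirds pq)
      finally show "3 * Gamma (2 / 3) * (Gamma (1 / 3) * (4 * pi * sqrt 3)) = 3 * q * (2 * pi * p)" by simp
    qed (use pos Gamma_third_nonzero in auto)
    finally show ?thesis by simp
  qed
  ultimately show ?thesis by (simp only: q_def)
qed

text \<open>For \<open>sinh\<close> each direction enters squared, once from \<open>dt\<close> and
  once from the slope; the squares differ by \<open>16 \<pi>^2 sqrt 3 \<i>\<close>.\<close>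

lemma sin_term_coeff_ratio_limit:
  "(\<lambda>n. (12 * pi) powr (- ((real n + 1) / 3)) / (pi * laplace_scale n ^ 2 * sin_term_coeff n)) \<longlonglongrightarrow>
     1 / (Gamma (2 / 3) / (3 * (16 * pi ^ 2 / 3) powr (2 / 3)) * (16 * pi ^ 2 * sqrt 3))"
proof -
  define p q u where "p = (12 * pi) powr (1 / 3)" and "q = (16 * pi ^ 2 / 3) powr (1 / 3)"
    and "u = (2 / 3 :: real) powr (1 / 3)"
  have pos: "0 < p" "0 < q" "0 < u" by (simp_all add: p_def q_def u_def)
  have pq: "p * q = 4 * pi" and u3: "u ^ 3 = 2 / 3"
    using cube_root_facts by (simp_all add: p_def q_def u_def)
  have "(12 * pi) powr (- ((real n + 1) / 3)) / (pi * laplace_scale n ^ 2 * sin_term_coeff n) =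
      Gamma (1 / 3) / (pi * p ^ 2 * u) * ((real n / 2 + 1/3) / ((real n + 1) / 3)) powr (2 / 3)" for n
  proof -
    define w where "w = (12 * pi) powr ((real n - 1) / 3)"
    have "(12 * pi) powr (- ((real n + 1) / 3)) = (12 * pi) powr (- ((real n - 1) / 3 + 2 / 3))"
      by (simp add: field_simps)
    also have "\<dots> = 1 / (w * p ^ 2)"
      by (simp only: w_def p_def powr_minus powr_add inverse_eq_divide) (simp add: cube_root_facts(2))
    finally have "(12 * pi) powr (- ((real n + 1) / 3)) = 1 / (w * p ^ 2)" .
    moreover have "((real n / 2 + 1/3) / ((real n + 1) / 3)) powr (2 / 3) =
        (real n / 2 + 1/3) powr (2 / 3) / laplace_scale n ^ 2"
      unfolding laplace_scale_def by (subst powr_divide) (simp add: cube_root_facts(2)[of "(real n + 1) / 3"])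
    moreover have "sin_term_coeff n = u / (Gamma (1 / 3) * (real n / 2 + 1/3) powr (2/3) * w)"
      by (simp add: sin_term_coeff_def u_def w_def)
    ultimately show ?thesis
      using Gamma_third_nonzero pos laplace_scale_pos[of n] by (simp add: w_def)
  qed
  moreover have "(\<lambda>n. Gamma (1 / 3) / (pi * p ^ 2 * u) * ((real n / 2 + 1/3) / ((real n + 1) / 3)) powr (2 / 3))
      \<longlonglongrightarrow> Gamma (1 / 3) / (pi * p ^ 2 * u) * (3 / 2) powr (2 / 3)"
    by (intro tendsto_intros index_ratio_limit)
  moreover have "Gamma (1 / 3) / (pi * p ^ 2 * u) * (3 / 2) powr (2 / 3) =
      1 / (Gamma (2 / 3) / (3 * q ^ 2) * (16 * pi ^ 2 * sqrt 3))"
  proof -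
    have "Gamma (1 / 3) / (pi * p ^ 2 * u) * (3 / 2) powr (2 / 3) = Gamma (1 / 3) / (pi * p ^ 2 * u ^ 3)"
      using pos by (simp add: cube_root_facts(2) cube_root_facts(4) flip: u_def) (simp add: eval_nat_numeral)
    also have "\<dots> = 3 * Gamma (1 / 3) / (2 * pi * p ^ 2)" by (simp add: u3)
    also have "\<dots> = 3 * q ^ 2 / (Gamma (2 / 3) * (16 * pi ^ 2 * sqrt 3))"
    proof (subst frac_eq_eq)
      have "3 * Gamma (1 / 3) * (Gamma (2 / 3) * (16 * pi ^ 2 * sqrt 3)) = 48 * pi ^ 2 * sqrt 3 * (Gamma (1 / 3) * Gamma (2 / 3))"
        by simp
      also have "\<dots> = 6 * pi * (p * q) ^ 2"
        by (simp add: Gamma_third_mult_two_thirds pq power2_eq_square)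
      finally show "3 * Gamma (1 / 3) * (Gamma (2 / 3) * (16 * pi ^ 2 * sqrt 3)) = 3 * q ^ 2 * (2 * pi * p ^ 2)"
        by (simp add: power_mult_distrib)
    qed (use pos Gamma_third_nonzero in auto)
    finally show ?thesis by simp
  qed
  moreover have "(16 * pi ^ 2 / 3) powr (2 / 3) = q ^ 2"
    by (simp add: q_def cube_root_facts(2))
  ultimately show ?thesis by (simp only:)
qed

lemma term_coeff_ratio_limit: "(\<lambda>n. sin_term_coeff n / cos_term_coeff n) \<longlonglongrightarrow> 0"
proof -
  define C where "C = (2/3) powr (1/3) * Gamma (2/3) * (12 * pi) powr (1/3) / ((2/3) powr (2/3) * Gamma (1/3))"
  have "sin_term_coeff n / cos_term_coeff n = C * (real n / 2 + 1/3) powr (- (1/3))" for n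
  proof -
    define v where "v = real n / 2 + 1/3"
    have v: "v > 0" by (simp add: v_def add_nonneg_pos)
    have "(12 * pi) powr (real n / 3) = (12 * pi) powr ((real n - 1) / 3 + 1/3)"
      by (simp add: field_simps)
    also have "\<dots> = (12 * pi) powr ((real n - 1) / 3) * (12 * pi) powr (1/3)" by (rule powr_add)
    finally have 1: "(12 * pi) powr (real n / 3) = (12 * pi) powr ((real n - 1) / 3) * (12 * pi) powr (1/3)" .
    have "v powr (2/3) = v powr (1/3) * v powr (1/3)"
      by (simp flip: powr_add)
    then show ?thesis
      unfolding sin_term_coeff_def cos_term_coeff_def C_def 1 v_def[symmetric] powr_minus
      using v Gamma_third_nonzero by (simp add: divide_simps)
  qed
  moreover have "(\<lambda>n. C * (real n / 2 + 1/3) powr (- (1/3))) \<longlonglongrightarrow> C * 0"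
    by (intro tendsto_mult tendsto_const) real_asymp
  ultimately show ?thesis by simp
qed

lemma term_coeffs_nonzero: "cos_term_coeff n \<noteq> 0" "sin_term_coeff n \<noteq> 0"
proof -
  have "real n / 2 + 1 / 3 \<noteq> 0" using of_nat_0_le_iff[of n, where 'a = real] by linarith
  then show "cos_term_coeff n \<noteq> 0" "sin_term_coeff n \<noteq> 0"
    using Gamma_third_nonzero by (simp_all add: cos_term_coeff_def sin_term_coeff_def)
qed

theorem mainTheorem5:
  fixes \<kappa> :: complex
  shows "(\<lambda>n. B n \<kappa>) \<sim>[sequentially]
    (\<lambda>n. complex_of_real
            ((2/3) powr (2/3) /
             (Gamma (2/3) * (real n / 2 + 1/3) powr (1/3) * (12 * pi) powr (real n / 3)))
          * cos (2 * complex_of_real pi * \<kappa> - complex_of_real (pi / 2) * of_nat n)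
        + complex_of_real
            ((2/3) powr (1/3) /
             (Gamma (1/3) * (real n / 2 + 1/3) powr (2/3) * (12 * pi) powr ((real n - 1) / 3)))
          * \<kappa> * sin (2 * complex_of_real pi * \<kappa> - complex_of_real (pi / 2) * of_nat n))"
proof -
  define \<theta> where "\<theta> = (\<lambda>n::nat. 2 * complex_of_real pi * \<kappa> - complex_of_real (pi / 2) * of_nat n)"
  define K where "K n = (12 * pi) powr (- ((real n + 1) / 3))" for n :: nat
  define dl dr where "dl = - apex - 2 * pi * \<i>" and "dr = apex - 2 * pi * \<i>"
  define C S where "C n = dl * edge_integral cosh \<kappa> n (- apex) - dr * edge_integral cosh \<kappa> n apex"
    and "S n = dl * edge_integral sinh \<kappa> n (- apex) - dr * edge_integral sinh \<kappa> n apex" for n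
  define a b where "a n = - of_real (K n / pi) * C n" and "b n = - of_real (K n / pi) * \<i> * S n" for n
  define X Y where "X = Gamma (1 / 3) / (3 * (16 * pi ^ 2 / 3) powr (1 / 3))"
    and "Y = Gamma (2 / 3) / (3 * (16 * pi ^ 2 / 3) powr (2 / 3))"
  have XY: "X \<noteq> 0" "Y \<noteq> 0" using Gamma_third_nonzero by (simp_all add: X_def Y_def)
  have B: "B n \<kappa> = a n * cos (\<theta> n) + b n * sin (\<theta> n)" for n
    unfolding B_edge_integrals[of n \<kappa>] a_def b_def C_def S_def K_def \<theta>_def dl_def dr_def
    by (simp only: distrib_left mult_ac)
  have a: "(\<lambda>n. a n / of_real (cos_term_coeff n)) \<longlonglongrightarrow> 1"
  proof -
    have "(\<lambda>n. - (dl * (of_real (laplace_scale n) * edge_integral cosh \<kappa> n (- apex))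
              - dr * (of_real (laplace_scale n) * edge_integral cosh \<kappa> n apex))
            * of_real (K n / (pi * laplace_scale n * cos_term_coeff n)))
       \<longlonglongrightarrow> - (dl * of_real X - dr * of_real X) * of_real (1 / (X * (4 * pi * sqrt 3)))"
      unfolding X_def K_def
      by (intro tendsto_intros edge_integral_cosh_limit cos_term_coeff_ratio_limit) auto
    also have "- (dl * of_real X - dr * of_real X) * of_real (1 / (X * (4 * pi * sqrt 3))) = 1"
    proof -
      have "- (dl * of_real X - dr * of_real X) = of_real (X * (4 * pi * sqrt 3))"
        by (simp add: dl_def dr_def apex_def algebra_simps)
      then show ?thesis using XY by (simp flip: of_real_mult)
    qed
    also have "(\<lambda>n. - (dl * (of_real (laplace_scale n) * edge_integral cosh \<kappa> n (- apex))
              - dr * (of_real (laplace_scale n) * edge_integral cosh \<kappa> n apex))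
            * of_real (K n / (pi * laplace_scale n * cos_term_coeff n))) =
        (\<lambda>n. a n / of_real (cos_term_coeff n))"
    proof
      fix n
      have "of_real (laplace_scale n) \<noteq> (0::complex)" using laplace_scale_pos[of n] by simp
      then show "- (dl * (of_real (laplace_scale n) * edge_integral cosh \<kappa> n (- apex))
              - dr * (of_real (laplace_scale n) * edge_integral cosh \<kappa> n apex))
            * of_real (K n / (pi * laplace_scale n * cos_term_coeff n)) = a n / of_real (cos_term_coeff n)"
        using term_coeffs_nonzero[of n] by (simp add: a_def C_def field_simps)
    qed
    finally show ?thesis .
  qed
  have b: "(\<lambda>n. b n / of_real (sin_term_coeff n)) \<longlonglongrightarrow> \<kappa>"
  proof -
    have "(\<lambda>n. - \<i> * (dl * (of_real (laplace_scale n) ^ 2 * edge_integral sinh \<kappa> n (- apex))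
              - dr * (of_real (laplace_scale n) ^ 2 * edge_integral sinh \<kappa> n apex))
            * of_real (K n / (pi * laplace_scale n ^ 2 * sin_term_coeff n)))
       \<longlonglongrightarrow> - \<i> * (dl * (\<kappa> * dl * of_real Y) - dr * (\<kappa> * dr * of_real Y)) *
            of_real (1 / (Y * (16 * pi ^ 2 * sqrt 3)))"
      unfolding Y_def K_def dl_def dr_def
      by (intro tendsto_intros edge_integral_sinh_limit sin_term_coeff_ratio_limit) auto
    also have "- \<i> * (dl * (\<kappa> * dl * of_real Y) - dr * (\<kappa> * dr * of_real Y)) *
            of_real (1 / (Y * (16 * pi ^ 2 * sqrt 3))) = \<kappa>"
    proof -
      have "- \<i> * (dl * (\<kappa> * dl * of_real Y) - dr * (\<kappa> * dr * of_real Y)) =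
          \<kappa> * of_real (Y * (16 * pi ^ 2 * sqrt 3))"
        by (simp add: dl_def dr_def apex_def power2_eq_square algebra_simps)
      moreover have "of_real (Y * (16 * pi ^ 2 * sqrt 3)) * of_real (1 / (Y * (16 * pi ^ 2 * sqrt 3))) = (1 :: complex)"
        using XY by (simp flip: of_real_mult)
      ultimately show ?thesis by (simp only: mult.assoc mult_1_right)
    qed
    also have "(\<lambda>n. - \<i> * (dl * (of_real (laplace_scale n) ^ 2 * edge_integral sinh \<kappa> n (- apex))
              - dr * (of_real (laplace_scale n) ^ 2 * edge_integral sinh \<kappa> n apex))
            * of_real (K n / (pi * laplace_scale n ^ 2 * sin_term_coeff n))) =
        (\<lambda>n. b n / of_real (sin_term_coeff n))"
    proof
      fix n
      have "of_real (laplace_scale n) \<noteq> (0::complex)" using laplace_scale_pos[of n] by simp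
      then show "- \<i> * (dl * (of_real (laplace_scale n) ^ 2 * edge_integral sinh \<kappa> n (- apex))
              - dr * (of_real (laplace_scale n) ^ 2 * edge_integral sinh \<kappa> n apex))
            * of_real (K n / (pi * laplace_scale n ^ 2 * sin_term_coeff n)) = b n / of_real (sin_term_coeff n)"
        using term_coeffs_nonzero[of n] by (simp add: b_def S_def field_simps)
    qed
    finally show ?thesis .
  qed
  \<comment> \<open>At \<open>\<kappa> = 0\<close> the second term of the target is zero, so a limit
    would not be enough: the integrals have to vanish exactly.\<close>
  have b0: "b n = 0" if "\<kappa> = 0" for n
    using that by (simp add: b_def S_def edge_integral_sinh_0)
  have ratio: "(\<lambda>n. complex_of_real (sin_term_coeff n) / of_real (cos_term_coeff n)) \<longlonglongrightarrow> 0"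
    using tendsto_of_real[OF term_coeff_ratio_limit, where 'a = complex] by simp
  obtain m M where bounds: "0 < m" "\<And>n. cos (\<theta> n) = 0 \<or> m \<le> norm (cos (\<theta> n))"
      "\<And>n. norm (sin (\<theta> n)) \<le> M"
    using cos_sin_shift_bounds[of "2 * complex_of_real pi * \<kappa>"] unfolding \<theta>_def by metis
  have "(\<lambda>n. a n * cos (\<theta> n) + b n * sin (\<theta> n)) \<sim>[sequentially]
      (\<lambda>n. of_real (cos_term_coeff n) * cos (\<theta> n) + of_real (sin_term_coeff n) * \<kappa> * sin (\<theta> n))"
    by (rule two_term_asymp_equiv[OF _ _ a b b0 ratio bounds(3,1,2)])
       (simp_all add: term_coeffs_nonzero)
  then show ?thesis
    unfolding B cos_term_coeff_def sin_term_coeff_def \<theta>_def .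
qed

end
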